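(* Consider the Gaussian sequence model with parameter space $\Theta(k_n,\tau_n)$, and let $\epsilon_n=k_n/n$, $\mu_n=\tau_n/\sigma_n$. Suppose $\epsilon_n\to0$, $\mu_n\to\infty$ and $\mu_n=o(\sqrt{\log\epsilon_n^{-1}})$ as $n\to\infty$. Then $$R(\Theta(k_n,\tau_n),\sigma_n)\ \ge\ n\sigma_n^2\left(\epsilon_n\mu_n^2-\tfrac12\epsilon_n^2\mu_n^2e^{\mu_n^2}(1+o(1))\right).$$ In addition, for the estimator $\hat\eta_E(y,\lambda_n,\gamma_n)$ with $\lambda_n=2\sigma_n\mu_n$ and $\gamma_n=(2\epsilon_n\mu_n^2e^{\frac32\mu_n^2})^{-1}-1$, $$R(\Theta(k_n,\tau_n),\sigma_n)\ \le\ \sup_{\theta\in\Theta(k_n,\tau_n)}\mathbb E_\theta\|\hat\eta_E(y,\lambda_n,\gamma_n)-\theta\|_2^2= n\sigma_n^2\left(\epsilon_n\mu_n^2-\big(\sqrt{2/\pi}+o(1)\big)\epsilon_n^2\mu_ne^{\mu_n^2}\right).$$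
   Context: Model: for each $n$, one observes $y=(y_1,\dots,y_n)$ with $y_i=\theta_i+\sigma_n z_i$, where $z_i$ are i.i.d. $\mathcal N(0,1)$, $\sigma_n>0$ is known and $\theta\in\mathbb R^n$ is unknown. For integers $1\le k_n\le n$ and $\tau_n>0$, $$\Theta(k_n,\tau_n)=\{\theta\in\mathbb R^n:\ \|\theta\|_0\le k_n,\ \|\theta\|_2^2\le k_n\tau_n^2\},$$ where $\|\theta\|_0$ is the number of nonzero coordinates. The minimax risk is $R(\Theta(k_n,\tau_n),\sigma_n)=\inf_{\hat\theta}\sup_{\theta\in\Theta(k_n,\tau_n)}\mathbb E_\theta\|\hat\theta-\theta\|_2^2$, the infimum being over all estimators (measurable functions of $y$). The estimator $\hat\eta_E$ has coordinates $[\hat\eta_E(y,\lambda,\gamma)]_i=\frac{1}{1+\gamma}\,\mathrm{sign}(y_i)(|y_i|-\lambda)_+$. Here $o(1)$ denotes a sequence tending to $0$ as $n\to\infty$, and $a_n=o(b_n)$ means $a_n/b_n\to 0$. *)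

theory Defs
  imports "HOL-Probability.Probability"
begin

text \<open>
  Vectors in \<open>\<real>\<^sup>n\<close>, with \<open>n\<close> varying, are functions on the index set \<open>{1..n}\<close> that are
  extensional, i.e. equal to \<open>undefined\<close> outside \<open>{1..n}\<close>; this is the space underlying the
  product \<open>\<sigma>\<close>-algebra below.
\<close>

abbreviation Rn :: "nat \<Rightarrow> (nat \<Rightarrow> real) measure" where
  "Rn n \<equiv> (\<Pi>\<^sub>M i\<in>{1..n}. (borel :: real measure))"

definition l0_norm :: "nat \<Rightarrow> (nat \<Rightarrow> real) \<Rightarrow> nat" where
  "l0_norm n \<theta> = card {i \<in> {1..n}. \<theta> i \<noteq> 0}"

definition l2_norm_sq :: "nat \<Rightarrow> (nat \<Rightarrow> real) \<Rightarrow> real" where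
  "l2_norm_sq n \<theta> = (\<Sum>i\<in>{1..n}. (\<theta> i)\<^sup>2)"

definition sparse_ball :: "nat \<Rightarrow> nat \<Rightarrow> real \<Rightarrow> (nat \<Rightarrow> real) set" where
  "sparse_ball n k \<tau> =
     {\<theta> \<in> extensional {1..n}. l0_norm n \<theta> \<le> k \<and> l2_norm_sq n \<theta> \<le> real k * \<tau>\<^sup>2}"

definition noise :: "nat \<Rightarrow> (nat \<Rightarrow> real) measure" where
  "noise n = (\<Pi>\<^sub>M i\<in>{1..n}. std_normal_distribution)"

definition obs_law :: "nat \<Rightarrow> real \<Rightarrow> (nat \<Rightarrow> real) \<Rightarrow> (nat \<Rightarrow> real) measure" where
  "obs_law n \<sigma> \<theta> = distr (noise n) (Rn n) (\<lambda>z. \<lambda>i\<in>{1..n}. \<theta> i + \<sigma> * z i)"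

definition estimators :: "nat \<Rightarrow> ((nat \<Rightarrow> real) \<Rightarrow> (nat \<Rightarrow> real)) set" where
  "estimators n = measurable (Rn n) (Rn n)"

text \<open>Risks are \<open>[0,\<infinity>]\<close>-valued, so that estimators of infinite risk need no special treatment.\<close>

definition sq_risk ::
  "nat \<Rightarrow> real \<Rightarrow> ((nat \<Rightarrow> real) \<Rightarrow> (nat \<Rightarrow> real)) \<Rightarrow> (nat \<Rightarrow> real) \<Rightarrow> ennreal" where
  "sq_risk n \<sigma> est \<theta> =
     (\<integral>\<^sup>+ y. ennreal (l2_norm_sq n (\<lambda>i. est y i - \<theta> i)) \<partial>obs_law n \<sigma> \<theta>)"

definition sup_risk ::
  "nat \<Rightarrow> real \<Rightarrow> (nat \<Rightarrow> real) set \<Rightarrow> ((nat \<Rightarrow> real) \<Rightarrow> (nat \<Rightarrow> real)) \<Rightarrow> ennreal" where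
  "sup_risk n \<sigma> \<Theta> est = (SUP \<theta>\<in>\<Theta>. sq_risk n \<sigma> est \<theta>)"

definition minimax_risk :: "nat \<Rightarrow> real \<Rightarrow> (nat \<Rightarrow> real) set \<Rightarrow> ennreal" where
  "minimax_risk n \<sigma> \<Theta> = (INF est\<in>estimators n. sup_risk n \<sigma> \<Theta> est)"

definition eta_E :: "nat \<Rightarrow> real \<Rightarrow> real \<Rightarrow> (nat \<Rightarrow> real) \<Rightarrow> (nat \<Rightarrow> real)" where
  "eta_E n lam \<gamma> y = (\<lambda>i\<in>{1..n}. 1 / (1 + \<gamma>) * sgn (y i) * max 0 (\<bar>y i\<bar> - lam))"

end

theory Submission
  imports Defs "HOL-Real_Asymp.Real_Asymp"
begin

text \<open>
  Lower bound: put the prior on vectors with one spike \<open>\<plusminus>\<tau>\<close> at a uniformly chosen position in each of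
  \<open>k\<close> disjoint blocks of size \<open>m = n div k\<close>. Such vectors lie in the parameter space, and with the
  other blocks frozen the posterior risk in one block is \<open>\<tau>\<^sup>2\<close> minus
  \<open>\<tau>\<^sup>2/m\<close> times the mean of \<open>(\<Sum>j. s\<^sub>j\<^sup>2) / (\<Sum>l. c\<^sub>l)\<close> under pure noise, where \<open>c\<^sub>l\<close>, \<open>s\<^sub>l\<close> are
  \<open>exp (- \<mu>\<^sup>2/2)\<close> times the hyperbolic cosine and sine of \<open>\<mu> z\<^sub>l\<close>. Since \<open>E c\<^sub>l = 1\<close>,
  \<open>E s\<^sub>j\<^sup>2 \<le> exp \<mu>\<^sup>2 / 2\<close> and the denominator concentrates at \<open>m \<approx> 1/\<epsilon>\<close>, the relative correction is
  \<open>\<epsilon> exp \<mu>\<^sup>2 / 2\<close> to first order.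

  Risk of the estimator: the coordinatewise risk at \<open>t\<close> is \<open>t\<^sup>2 - 2 c t M(t) + c\<^sup>2 V(t)\<close> with \<open>M\<close>, \<open>V\<close> the
  mean and second moment of the soft-thresholded observation. The function \<open>t M(t)\<close> is convex in
  \<open>t\<^sup>2\<close>, so under the two constraints the worst case has all \<open>k\<close> spikes equal to
  \<open>\<mu>\<close>, up to terms controlled by \<open>c\<^sup>2 V\<close>. Gaussian tail asymptotics give
  \<open>n c\<^sup>2 V(0)\<close> and \<open>2 c k \<mu> M(\<mu>)\<close> to first order, and they differ by a factor \<open>2\<close>.
\<close>

subsection \<open>Shifts and factorisation for Gaussian product measures\<close>

lemma prob_space_std_normal: "prob_space std_normal_distribution"
  by (rule prob_space_normal_density) simp

text \<open>The weight \<open>exp (v * x - v\<^sup>2 / 2)\<close> is the density of N(v, 1) relative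
  to N(0, 1). Nonnegative integrals keep the identity free of integrability conditions on
  \<open>h\<close>.\<close>

lemma nn_integral_std_normal_shift:
  assumes [measurable]: "h \<in> borel_measurable borel"
  shows "(\<integral>\<^sup>+x. h (x + v) \<partial>std_normal_distribution)
       = (\<integral>\<^sup>+x. ennreal (exp (v * x - v\<^sup>2 / 2)) * h x \<partial>std_normal_distribution)"
proof -
  have "(\<integral>\<^sup>+x. ennreal (exp (v * x - v\<^sup>2 / 2)) * h x \<partial>std_normal_distribution)
      = (\<integral>\<^sup>+x. ennreal (std_normal_density (x - v)) * h x \<partial>lborel)"
  proof (subst nn_integral_density)
    have "std_normal_density x * exp (v * x - v\<^sup>2 / 2) = std_normal_density (x - v)" for x
      by (simp add: std_normal_density_def exp_add[symmetric] power2_eq_square field_simps)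
    then show "(\<integral>\<^sup>+x. ennreal (std_normal_density x) * (ennreal (exp (v * x - v\<^sup>2 / 2)) * h x) \<partial>lborel)
        = (\<integral>\<^sup>+x. ennreal (std_normal_density (x - v)) * h x \<partial>lborel)"
      by (simp add: mult.assoc[symmetric] ennreal_mult[symmetric])
  qed simp_all
  also have "\<dots> = (\<integral>\<^sup>+x. ennreal (std_normal_density x) * h (v + x) \<partial>lborel)"
    by (subst nn_integral_real_affine[where c = 1 and t = v]) auto
  also have "\<dots> = (\<integral>\<^sup>+x. h (x + v) \<partial>std_normal_distribution)"
    by (subst nn_integral_density) (auto simp: add.commute)
  finally show ?thesis ..
qed

text \<open>The shift formula with constant \<open>h\<close> says that the tilt has mass one, which
  is the Gaussian moment generating function.\<close>

lemma nn_integral_std_normal_exp: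
  "(\<integral>\<^sup>+x. ennreal (exp (v * x)) \<partial>std_normal_distribution) = ennreal (exp (v\<^sup>2 / 2))"
proof -
  interpret prob_space std_normal_distribution by (rule prob_space_std_normal)
  have "(\<integral>\<^sup>+x. ennreal (exp (v * x)) \<partial>std_normal_distribution)
      = (\<integral>\<^sup>+x. ennreal (exp (v\<^sup>2 / 2)) * ennreal (exp (v * x - v\<^sup>2 / 2)) \<partial>std_normal_distribution)"
    by (intro nn_integral_cong) (simp add: ennreal_mult[symmetric] exp_add[symmetric])
  also have "\<dots> = ennreal (exp (v\<^sup>2 / 2)) *
      (\<integral>\<^sup>+x. ennreal (exp (v * x - v\<^sup>2 / 2)) \<partial>std_normal_distribution)"
    by (rule nn_integral_cmult) simp
  also have "(\<integral>\<^sup>+x. ennreal (exp (v * x - v\<^sup>2 / 2)) \<partial>std_normal_distribution) = 1"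
    using nn_integral_std_normal_shift[of "\<lambda>_. 1" v] emeasure_space_1 by simp
  finally show ?thesis by simp
qed

lemma nn_integral_PiM_insert_coord:
  fixes M :: "real measure"
  assumes "prob_space M" and I: "finite I" "j \<in> I"
    and f: "f \<in> borel_measurable (PiM I (\<lambda>_. M))"
  shows "(\<integral>\<^sup>+z. f z \<partial>PiM I (\<lambda>_. M))
       = (\<integral>\<^sup>+x. (\<integral>\<^sup>+y. f (x(j := y)) \<partial>M) \<partial>PiM (I - {j}) (\<lambda>_. M))"
proof -
  interpret prob_space M by fact
  interpret product_sigma_finite "\<lambda>_::'a. M" ..
  have ins: "insert j (I - {j}) = I" using I by auto
  show ?thesis
    using product_nn_integral_insert[of "I - {j}" j f] I f unfolding ins by simp
qed

lemma measurable_PiM_update: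
  assumes f: "f \<in> borel_measurable (PiM I (\<lambda>_. M))" and "j \<in> I"
  shows "(\<lambda>(x, y). f (x(j := y))) \<in> borel_measurable (PiM (I - {j}) (\<lambda>_. M) \<Otimes>\<^sub>M M)"
proof -
  have ins: "insert j (I - {j}) = I" using assms by auto
  have "(\<lambda>(x, y). x(j := y)) \<in> measurable (PiM (I - {j}) (\<lambda>_. M) \<Otimes>\<^sub>M M) (PiM I (\<lambda>_. M))"
    using measurable_add_dim[of j "I - {j}" "\<lambda>_. M"] unfolding ins .
  from measurable_compose[OF this f] show ?thesis
    by (simp add: case_prod_unfold)
qed

text \<open>Independence of coordinate \<open>j\<close> from a function that ignores it. Ignoring is
  phrased as invariance under updates, which simplification verifies for concrete
  \<open>g\<close>.\<close>

lemma nn_integral_PiM_factor: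
  fixes M :: "real measure"
  assumes M: "prob_space M" and I: "finite I" "j \<in> I"
    and f[measurable]: "f \<in> borel_measurable M"
    and g[measurable]: "g \<in> borel_measurable (PiM I (\<lambda>_. M))"
    and g_upd: "\<And>z y. g (z(j := y)) = g z"
  shows "(\<integral>\<^sup>+z. f (z j) * g z \<partial>PiM I (\<lambda>_. M)) = (\<integral>\<^sup>+y. f y \<partial>M) * (\<integral>\<^sup>+z. g z \<partial>PiM I (\<lambda>_. M))"
proof -
  interpret prob_space M by fact
  \<comment> \<open>Freezing coordinate \<open>j\<close> at a point of the space exhibits
    \<open>g\<close> as measurable on the product over the remaining coordinates.\<close>
  obtain y0 where y0: "y0 \<in> space M" using not_empty by auto
  have [measurable]: "g \<in> borel_measurable (PiM (I - {j}) (\<lambda>_. M))"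
    using measurable_compose[OF measurable_Pair2'[OF y0] measurable_PiM_update[OF g I(2)]]
    by (simp add: g_upd)
  have [measurable]: "(\<lambda>z. z j) \<in> measurable (PiM I (\<lambda>_. M)) M"
    using I by measurable
  have "(\<integral>\<^sup>+z. f (z j) * g z \<partial>PiM I (\<lambda>_. M))
      = (\<integral>\<^sup>+x. (\<integral>\<^sup>+y. f y * g x \<partial>M) \<partial>PiM (I - {j}) (\<lambda>_. M))"
    by (subst nn_integral_PiM_insert_coord[OF M I]) (simp_all add: g_upd)
  also have "\<dots> = (\<integral>\<^sup>+y. f y \<partial>M) * (\<integral>\<^sup>+x. g x \<partial>PiM (I - {j}) (\<lambda>_. M))"
    by (simp add: nn_integral_multc nn_integral_cmult)
  also have "(\<integral>\<^sup>+x. g x \<partial>PiM (I - {j}) (\<lambda>_. M)) = (\<integral>\<^sup>+z. g z \<partial>PiM I (\<lambda>_. M))"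
    by (subst nn_integral_PiM_insert_coord[OF M I g]) (simp add: g_upd emeasure_space_1)
  finally show ?thesis .
qed

lemma nn_integral_PiM_component:
  fixes M :: "real measure"
  assumes M: "prob_space M" and I: "finite I" "j \<in> I"
    and f[measurable]: "f \<in> borel_measurable M"
  shows "(\<integral>\<^sup>+z. f (z j) \<partial>PiM I (\<lambda>_. M)) = (\<integral>\<^sup>+y. f y \<partial>M)"
proof -
  interpret P: prob_space "PiM I (\<lambda>_. M)" by (rule prob_space_PiM) (rule M)
  show ?thesis
    using nn_integral_PiM_factor[OF M I f, of "\<lambda>_. 1"] by (simp add: P.emeasure_space_1)
qed

text \<open>Fubini in coordinate \<open>l\<close> reduces this to dimension one. It trades a spike
  in the mean for a likelihood ratio under pure noise.\<close>

lemma nn_integral_PiM_std_normal_shift: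
  assumes I: "finite I" "l \<in> I"
    and H: "H \<in> borel_measurable (PiM I (\<lambda>_. std_normal_distribution))"
  shows "(\<integral>\<^sup>+z. H (z(l := z l + v)) \<partial>PiM I (\<lambda>_. std_normal_distribution))
       = (\<integral>\<^sup>+z. ennreal (exp (v * z l - v\<^sup>2 / 2)) * H z \<partial>PiM I (\<lambda>_. std_normal_distribution))"
proof -
  let ?N = "std_normal_distribution" let ?P = "\<lambda>I. PiM I (\<lambda>_. std_normal_distribution)"
  note N = prob_space_std_normal
  have l[measurable]: "(\<lambda>z. z l) \<in> measurable (?P I) borel"
    using measurable_component_singleton[OF I(2), of "\<lambda>_. ?N"] by simp
  note [measurable] = H
  have "(\<lambda>z. z(l := z l + v)) \<in> measurable (?P I) (?P I)"
    by (rule measurable_fun_upd[where J = I]) (use I l in auto)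
  from measurable_compose[OF this H]
  have m: "(\<lambda>z. H (z(l := z l + v))) \<in> borel_measurable (?P I)" .
  have "(\<integral>\<^sup>+z. H (z(l := z l + v)) \<partial>?P I)
      = (\<integral>\<^sup>+x. (\<integral>\<^sup>+y. H (x(l := y + v)) \<partial>?N) \<partial>?P (I - {l}))"
    by (subst nn_integral_PiM_insert_coord[OF N I m]) simp
  also have "\<dots> = (\<integral>\<^sup>+x. (\<integral>\<^sup>+y. ennreal (exp (v * y - v\<^sup>2 / 2)) * H (x(l := y)) \<partial>?N) \<partial>?P (I - {l}))"
  proof (rule nn_integral_cong)
    fix x assume x: "x \<in> space (?P (I - {l}))"
    have "(\<lambda>y. H (x(l := y))) \<in> borel_measurable ?N"
      using measurable_compose[OF measurable_Pair1'[OF x] measurable_PiM_update[OF H I(2)]] by simp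
    then show "(\<integral>\<^sup>+y. H (x(l := y + v)) \<partial>?N) = (\<integral>\<^sup>+y. ennreal (exp (v * y - v\<^sup>2 / 2)) * H (x(l := y)) \<partial>?N)"
      by (intro nn_integral_std_normal_shift[of "\<lambda>y. H (x(l := y))"]) simp
  qed
  also have "\<dots> = (\<integral>\<^sup>+z. ennreal (exp (v * z l - v\<^sup>2 / 2)) * H z \<partial>?P I)"
    by (subst nn_integral_PiM_insert_coord[OF N I]) simp_all
  finally show ?thesis .
qed

subsection \<open>Averaged spike likelihoods\<close>

text \<open>The average of the likelihood ratios of N(\<mu>, 1) and N(-\<mu>, 1) relative to N(0,
  1), that is, of a spike with random sign. \<open>spike_sinh\<close> is half their difference and
  yields the numerator of the posterior mean.\<close>

definition spike_cosh :: "real \<Rightarrow> real \<Rightarrow> real" where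
  "spike_cosh \<mu> x = exp (- \<mu>\<^sup>2 / 2) * cosh (\<mu> * x)"

definition spike_sinh :: "real \<Rightarrow> real \<Rightarrow> real" where
  "spike_sinh \<mu> x = exp (- \<mu>\<^sup>2 / 2) * sinh (\<mu> * x)"

lemma borel_measurable_spike [measurable]:
  "spike_cosh \<mu> \<in> borel_measurable borel" "spike_sinh \<mu> \<in> borel_measurable borel"
  by (auto simp: spike_cosh_def[abs_def] spike_sinh_def[abs_def] cosh_def sinh_def)

lemma spike_cosh_ge: "exp (- \<mu>\<^sup>2 / 2) \<le> spike_cosh \<mu> x"
  by (simp add: spike_cosh_def cosh_real_ge_1)

lemma spike_cosh_pos: "0 < spike_cosh \<mu> x"
  using spike_cosh_ge[of \<mu> x] by (rule less_le_trans[rotated]) simp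

lemma nn_integral_spike_cosh:
  "(\<integral>\<^sup>+x. ennreal (spike_cosh \<mu> x) \<partial>std_normal_distribution) = 1"
proof -
  have "(\<integral>\<^sup>+x. ennreal (spike_cosh \<mu> x) \<partial>std_normal_distribution)
      = (\<integral>\<^sup>+x. ennreal (exp (- \<mu>\<^sup>2 / 2) / 2) * (ennreal (exp (\<mu> * x)) + ennreal (exp (- \<mu> * x)))
          \<partial>std_normal_distribution)"
    by (intro nn_integral_cong)
       (simp add: spike_cosh_def cosh_def ennreal_mult[symmetric] ennreal_plus[symmetric] del: ennreal_plus)
  also have "\<dots> = ennreal (exp (- \<mu>\<^sup>2 / 2) / 2) * (ennreal (exp (\<mu>\<^sup>2 / 2)) + ennreal (exp (\<mu>\<^sup>2 / 2)))"
    using nn_integral_std_normal_exp[of \<mu>] nn_integral_std_normal_exp[of "- \<mu>"]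
    by (simp add: nn_integral_cmult nn_integral_add)
  also have "\<dots> = 1"
    by (simp add: ennreal_mult[symmetric] ennreal_plus[symmetric] exp_add[symmetric] del: ennreal_plus)
  finally show ?thesis .
qed

text \<open>The exact values are \<open>cosh (\<mu>\<^sup>2)\<close> and
  \<open>sinh (\<mu>\<^sup>2)\<close>. The second bound keeps the leading constant 1/2, which
  reappears in the final lower bound; the first may lose a factor because it only enters a vanishing
  correction.\<close>

lemma nn_integral_spike_squares:
  shows nn_integral_spike_cosh_sq:
      "(\<integral>\<^sup>+x. ennreal ((spike_cosh \<mu> x)\<^sup>2) \<partial>std_normal_distribution) \<le> ennreal (exp (\<mu>\<^sup>2))" (is ?C)
    and nn_integral_spike_sinh_sq:
      "(\<integral>\<^sup>+x. ennreal ((spike_sinh \<mu> x)\<^sup>2) \<partial>std_normal_distribution) \<le> ennreal (exp (\<mu>\<^sup>2) / 2)" (is ?S)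
proof -
  interpret prob_space std_normal_distribution by (rule prob_space_std_normal)
  let ?N = std_normal_distribution
  have sq: "exp a * exp a = exp (2 * a)" for a :: real
    by (simp add: exp_add[symmetric])
  have exp2: "(\<integral>\<^sup>+x. ennreal (exp (2 * \<mu> * x)) + ennreal (exp (- (2 * \<mu>) * x)) \<partial>?N)
      = ennreal (2 * exp (2 * \<mu>\<^sup>2))"
    using nn_integral_std_normal_exp[of "2 * \<mu>"] nn_integral_std_normal_exp[of "- (2 * \<mu>)"]
    by (subst nn_integral_add)
       (simp_all add: ennreal_plus[symmetric] power_mult_distrib del: ennreal_plus)
  have "(\<integral>\<^sup>+x. ennreal ((spike_cosh \<mu> x)\<^sup>2) \<partial>?N)
      = (\<integral>\<^sup>+x. ennreal (exp (- \<mu>\<^sup>2) / 4) *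
          ((ennreal (exp (2 * \<mu> * x)) + ennreal (exp (- (2 * \<mu>) * x))) + 2) \<partial>?N)"
  proof (intro nn_integral_cong)
    fix x
    have "(spike_cosh \<mu> x)\<^sup>2 = exp (- \<mu>\<^sup>2) / 4 * (exp (2 * \<mu> * x) + exp (- (2 * \<mu>) * x) + 2)"
      by (simp add: spike_cosh_def cosh_def power2_eq_square field_simps exp_add[symmetric] exp_minus sq)
    then show "ennreal ((spike_cosh \<mu> x)\<^sup>2) = ennreal (exp (- \<mu>\<^sup>2) / 4) *
          ((ennreal (exp (2 * \<mu> * x)) + ennreal (exp (- (2 * \<mu>) * x))) + 2)"
      by (simp add: ennreal_mult[symmetric] ennreal_plus[symmetric] ennreal_numeral[symmetric]
            del: ennreal_plus ennreal_numeral)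
  qed
  also have "\<dots> = ennreal (exp (- \<mu>\<^sup>2) / 4) * (ennreal (2 * exp (2 * \<mu>\<^sup>2)) + 2)"
    by (subst nn_integral_cmult, simp, subst nn_integral_add) (simp_all only: exp2, simp_all add: emeasure_space_1[simplified])
  also have "\<dots> = ennreal (exp (- \<mu>\<^sup>2) / 4 * (2 * exp (2 * \<mu>\<^sup>2) + 2))"
    by (simp add: ennreal_mult[symmetric] ennreal_plus[symmetric] ennreal_numeral[symmetric]
            del: ennreal_plus ennreal_numeral)
  also have "\<dots> \<le> ennreal (exp (\<mu>\<^sup>2))"
  proof (rule ennreal_leI)
    have "2 * exp (2 * \<mu>\<^sup>2) + 2 \<le> 4 * exp (2 * \<mu>\<^sup>2)" by simp
    then have "exp (- \<mu>\<^sup>2) / 4 * (2 * exp (2 * \<mu>\<^sup>2) + 2) \<le> exp (- \<mu>\<^sup>2) / 4 * (4 * exp (2 * \<mu>\<^sup>2))"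
      by (intro mult_left_mono) auto
    also have "\<dots> = exp (\<mu>\<^sup>2)" by (simp add: exp_add[symmetric])
    finally show "exp (- \<mu>\<^sup>2) / 4 * (2 * exp (2 * \<mu>\<^sup>2) + 2) \<le> exp (\<mu>\<^sup>2)" .
  qed
  finally show ?C .
  have "(\<integral>\<^sup>+x. ennreal ((spike_sinh \<mu> x)\<^sup>2) \<partial>?N)
      \<le> (\<integral>\<^sup>+x. ennreal (exp (- \<mu>\<^sup>2) / 4) *
          (ennreal (exp (2 * \<mu> * x)) + ennreal (exp (- (2 * \<mu>) * x))) \<partial>?N)"
  proof (intro nn_integral_mono)
    fix x
    have "(spike_sinh \<mu> x)\<^sup>2 = exp (- \<mu>\<^sup>2) / 4 * (exp (2 * \<mu> * x) + exp (- (2 * \<mu>) * x) - 2)"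
      by (simp add: spike_sinh_def sinh_def power2_eq_square field_simps exp_add[symmetric] exp_minus sq)
    also have "\<dots> \<le> exp (- \<mu>\<^sup>2) / 4 * (exp (2 * \<mu> * x) + exp (- (2 * \<mu>) * x))"
      by (intro mult_left_mono) auto
    finally show "ennreal ((spike_sinh \<mu> x)\<^sup>2) \<le> ennreal (exp (- \<mu>\<^sup>2) / 4) *
          (ennreal (exp (2 * \<mu> * x)) + ennreal (exp (- (2 * \<mu>) * x)))"
      by (simp add: ennreal_mult[symmetric] ennreal_plus[symmetric] ennreal_leI del: ennreal_plus)
  qed
  also have "\<dots> = ennreal (exp (- \<mu>\<^sup>2) / 4) * ennreal (2 * exp (2 * \<mu>\<^sup>2))"
    by (subst nn_integral_cmult) (simp, simp only: exp2)
  also have "\<dots> = ennreal (exp (\<mu>\<^sup>2) / 2)"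
    by (simp add: ennreal_mult[symmetric] exp_add[symmetric])
  finally show ?S .
qed

text \<open>The elementary inequality \<open>1/X \<le> 1 - (X - 1) + K (X - 1)\<^sup>2\<close> for \<open>X \<ge> 1/K\<close> reduces the
  inverse moment to the first two moments.\<close>

lemma nn_integral_inverse_sum_spike_cosh:
  assumes I: "finite I" "L \<subseteq> I" and "L \<noteq> {}"
  shows "(\<integral>\<^sup>+z. ennreal (1 / (\<Sum>l\<in>L. spike_cosh \<mu> (z l))) \<partial>PiM I (\<lambda>_. std_normal_distribution))
       \<le> ennreal ((1 + exp (3 / 2 * \<mu>\<^sup>2) / real (card L)) / real (card L))"
proof -
  let ?P = "PiM I (\<lambda>_. std_normal_distribution)"
  note N = prob_space_std_normal
  interpret P: prob_space ?P by (rule prob_space_PiM) (rule N)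
  have fL: "finite L" using I finite_subset by blast
  define m where "m = real (card L)"
  have m: "m > 0" using fL \<open>L \<noteq> {}\<close> by (simp add: m_def card_gt_0_iff)
  have [measurable]: "(\<lambda>z. z l) \<in> measurable ?P borel" if "l \<in> L" for l
    using measurable_component_singleton[of l I "\<lambda>_. std_normal_distribution"] that I by auto
  \<comment> \<open>\<open>1 / K\<close> is the pointwise floor of \<open>spike_cosh\<close>, hence
    also a floor for the normalised average \<open>X\<close>.\<close>
  define K where "K = exp (\<mu>\<^sup>2 / 2)"
  have K: "K > 0" by (simp add: K_def)
  define X where "X z = (\<Sum>l\<in>L. spike_cosh \<mu> (z l)) / m" for z
  have X_meas[measurable]: "X \<in> borel_measurable ?P" by (simp add: X_def[abs_def])
  have X_ge: "1 / K \<le> X z" for z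
  proof -
    have "m * (1 / K) = (\<Sum>l\<in>L. exp (- \<mu>\<^sup>2 / 2))"
      by (simp add: m_def K_def exp_minus inverse_eq_divide)
    also have "\<dots> \<le> (\<Sum>l\<in>L. spike_cosh \<mu> (z l))"
      by (intro sum_mono spike_cosh_ge)
    finally show ?thesis using m by (simp add: X_def field_simps)
  qed
  then have X_pos: "X z > 0" for z
    using K by (meson divide_pos_pos less_le_trans zero_less_one)
  have comp: "(\<integral>\<^sup>+z. ennreal (spike_cosh \<mu> (z l)) \<partial>?P) = 1" if "l \<in> L" for l
    using nn_integral_PiM_component[OF N, of I l "\<lambda>x. ennreal (spike_cosh \<mu> x)"] that I
    by (auto simp: nn_integral_spike_cosh)
  have EX: "(\<integral>\<^sup>+z. ennreal (X z) \<partial>?P) = 1"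
  proof -
    have "(\<integral>\<^sup>+z. ennreal (X z) \<partial>?P) = (\<integral>\<^sup>+z. ennreal (1 / m) * (\<Sum>l\<in>L. ennreal (spike_cosh \<mu> (z l))) \<partial>?P)"
      using m by (intro nn_integral_cong)
        (simp add: X_def sum_nonneg less_imp_le[OF spike_cosh_pos] ennreal_mult[symmetric])
    also have "\<dots> = ennreal (1 / m) * (\<Sum>l\<in>L. \<integral>\<^sup>+z. ennreal (spike_cosh \<mu> (z l)) \<partial>?P)"
      by (subst nn_integral_cmult, simp, subst nn_integral_sum) simp_all
    also have "(\<Sum>l\<in>L. \<integral>\<^sup>+z. ennreal (spike_cosh \<mu> (z l)) \<partial>?P) = (\<Sum>l\<in>L. 1)"
      by (intro sum.cong) (auto simp: comp)
    also have "\<dots> = ennreal m"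
      by (simp add: m_def ennreal_of_nat_eq_real_of_nat)
    finally show ?thesis using m by (simp add: ennreal_mult[symmetric])
  qed
  have EXX: "(\<integral>\<^sup>+z. ennreal ((X z)\<^sup>2) \<partial>?P) \<le> ennreal (1 + exp (\<mu>\<^sup>2) / m)"
  proof -
    \<comment> \<open>Distinct coordinates are independent with mean one; only the diagonal sees the
      second moment.\<close>
    have pair: "(\<integral>\<^sup>+z. ennreal (spike_cosh \<mu> (z l)) * ennreal (spike_cosh \<mu> (z j)) \<partial>?P)
        \<le> ennreal (if l = j then exp (\<mu>\<^sup>2) else 1)" if "l \<in> L" "j \<in> L" for l j
    proof (cases "l = j")
      case True
      have "(\<integral>\<^sup>+z. ennreal (spike_cosh \<mu> (z l)) * ennreal (spike_cosh \<mu> (z j)) \<partial>?P)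
          = (\<integral>\<^sup>+z. ennreal ((spike_cosh \<mu> (z l))\<^sup>2) \<partial>?P)"
        using True by (simp add: power2_eq_square ennreal_mult[symmetric] less_imp_le[OF spike_cosh_pos])
      also have "\<dots> \<le> ennreal (exp (\<mu>\<^sup>2))"
        using nn_integral_PiM_component[OF N, of I l "\<lambda>x. ennreal ((spike_cosh \<mu> x)\<^sup>2)"] that I
          nn_integral_spike_cosh_sq[of \<mu>] by auto
      finally show ?thesis using True by simp
    next
      case False
      then show ?thesis
        using nn_integral_PiM_factor[OF N, of I l "\<lambda>x. ennreal (spike_cosh \<mu> x)"
            "\<lambda>z. ennreal (spike_cosh \<mu> (z j))"] that I
        by (auto simp: nn_integral_spike_cosh comp)
    qed
    have "(\<integral>\<^sup>+z. ennreal ((X z)\<^sup>2) \<partial>?P) = (\<integral>\<^sup>+z. ennreal (1 / m\<^sup>2) *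
        (\<Sum>l\<in>L. \<Sum>j\<in>L. ennreal (spike_cosh \<mu> (z l)) * ennreal (spike_cosh \<mu> (z j))) \<partial>?P)"
    proof (intro nn_integral_cong)
      fix z
      have "(X z)\<^sup>2 = 1 / m\<^sup>2 * (\<Sum>l\<in>L. \<Sum>j\<in>L. spike_cosh \<mu> (z l) * spike_cosh \<mu> (z j))"
        by (simp add: X_def power_divide power2_eq_square sum_product)
      then show "ennreal ((X z)\<^sup>2) = ennreal (1 / m\<^sup>2) *
        (\<Sum>l\<in>L. \<Sum>j\<in>L. ennreal (spike_cosh \<mu> (z l)) * ennreal (spike_cosh \<mu> (z j)))"
        by (simp add: sum_nonneg less_imp_le[OF spike_cosh_pos] ennreal_mult[symmetric])
    qed
    also have "\<dots> = ennreal (1 / m\<^sup>2) *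
        (\<Sum>l\<in>L. \<Sum>j\<in>L. \<integral>\<^sup>+z. ennreal (spike_cosh \<mu> (z l)) * ennreal (spike_cosh \<mu> (z j)) \<partial>?P)"
      by (subst nn_integral_cmult, simp, subst nn_integral_sum, simp)
         (auto intro!: arg_cong2[where f = times] sum.cong nn_integral_sum)
    also have "\<dots> \<le> ennreal (1 / m\<^sup>2) * (\<Sum>l\<in>L. \<Sum>j\<in>L. ennreal (if l = j then exp (\<mu>\<^sup>2) else 1))"
      by (intro mult_left_mono sum_mono pair) auto
    also have "\<dots> = ennreal (1 / m\<^sup>2 * (\<Sum>l\<in>L. \<Sum>j\<in>L. (if l = j then exp (\<mu>\<^sup>2) else 1)))"
      by (simp add: sum_nonneg ennreal_mult[symmetric])
    also have "\<dots> \<le> ennreal (1 / m\<^sup>2 * (\<Sum>l\<in>L. \<Sum>j\<in>L. 1 + (if j = l then exp (\<mu>\<^sup>2) else 0)))"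
      by (intro ennreal_leI mult_left_mono sum_mono) auto
    also have "(\<Sum>l\<in>L. \<Sum>j\<in>L. 1 + (if j = l then exp (\<mu>\<^sup>2) else 0)) = m\<^sup>2 + m * exp (\<mu>\<^sup>2)"
      using fL by (simp add: sum.distrib m_def power2_eq_square algebra_simps)
    also have "1 / m\<^sup>2 * (m\<^sup>2 + m * exp (\<mu>\<^sup>2)) = 1 + exp (\<mu>\<^sup>2) / m"
      using m by (simp add: field_simps power2_eq_square)
    finally show ?thesis .
  qed
  \<comment> \<open>This is \<open>1 / X \<le> 1 - (X - 1) + K * (X - 1)\<^sup>2\<close> with the
    negative terms moved across, since subtraction in \<open>ennreal\<close> truncates. The mean of
    \<open>X\<close> being one, the added term later cancels.\<close>
  have point: "ennreal (1 / X z) + ennreal (1 + 2 * K) * ennreal (X z)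
      \<le> ennreal (2 + K) + ennreal K * ennreal ((X z)\<^sup>2)" for z
  proof -
    have "(1 / X z) * (X z - 1)\<^sup>2 \<le> K * (X z - 1)\<^sup>2"
      using X_ge[of z] X_pos[of z] K by (intro mult_right_mono) (auto simp: field_simps)
    moreover have "(1 / X z) * (X z - 1)\<^sup>2 = 1 / X z - 2 + X z"
      using X_pos[of z] by (simp add: field_simps power2_eq_square)
    ultimately have "1 / X z + (1 + 2 * K) * X z \<le> (2 + K) + K * (X z)\<^sup>2"
      by (simp add: power2_eq_square algebra_simps)
    then show ?thesis
      using K X_pos[of z]
      by (simp add: ennreal_mult[symmetric] ennreal_plus[symmetric] ennreal_leI del: ennreal_plus)
  qed
  have "(\<integral>\<^sup>+z. ennreal (1 / X z) \<partial>?P) + ennreal (1 + 2 * K)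
      = (\<integral>\<^sup>+z. ennreal (1 / X z) + ennreal (1 + 2 * K) * ennreal (X z) \<partial>?P)"
    by (simp add: nn_integral_add nn_integral_cmult EX)
  also have "\<dots> \<le> (\<integral>\<^sup>+z. ennreal (2 + K) + ennreal K * ennreal ((X z)\<^sup>2) \<partial>?P)"
    by (intro nn_integral_mono point)
  also have "\<dots> = ennreal (2 + K) + ennreal K * (\<integral>\<^sup>+z. ennreal ((X z)\<^sup>2) \<partial>?P)"
    by (simp add: nn_integral_add nn_integral_cmult P.emeasure_space_1)
  also have "\<dots> \<le> ennreal (2 + K) + ennreal K * ennreal (1 + exp (\<mu>\<^sup>2) / m)"
    by (intro add_left_mono mult_left_mono EXX) auto
  also have "\<dots> = ennreal (1 + K * exp (\<mu>\<^sup>2) / m) + ennreal (1 + 2 * K)"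
    using K m by (simp add: ennreal_mult[symmetric] ennreal_plus[symmetric] field_simps del: ennreal_plus)
  finally have E: "(\<integral>\<^sup>+z. ennreal (1 / X z) \<partial>?P) \<le> ennreal (1 + K * exp (\<mu>\<^sup>2) / m)"
    unfolding add.commute[of _ "ennreal (1 + 2 * K)"] by (simp add: ennreal_add_left_cancel_le)
  have "(\<integral>\<^sup>+z. ennreal (1 / (\<Sum>l\<in>L. spike_cosh \<mu> (z l))) \<partial>?P) = (\<integral>\<^sup>+z. ennreal (1 / m) * ennreal (1 / X z) \<partial>?P)"
    using m X_pos by (intro nn_integral_cong) (simp add: X_def ennreal_mult[symmetric] sum_nonneg less_imp_le[OF spike_cosh_pos])
  also have "\<dots> = ennreal (1 / m) * (\<integral>\<^sup>+z. ennreal (1 / X z) \<partial>?P)"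
    by (rule nn_integral_cmult) simp
  also have "\<dots> \<le> ennreal (1 / m) * ennreal (1 + K * exp (\<mu>\<^sup>2) / m)"
    by (intro mult_left_mono E) simp
  also have "\<dots> = ennreal (1 / m * (1 + K * exp (\<mu>\<^sup>2) / m))"
    using m K by (intro ennreal_mult[symmetric]) auto
  \<comment> \<open>The exponent \<open>3 / 2 * \<mu>\<^sup>2\<close> combines
    \<open>exp (\<mu>\<^sup>2)\<close> from the second moment with \<open>K\<close> from the
    pointwise floor.\<close>
  also have "1 / m * (1 + K * exp (\<mu>\<^sup>2) / m) = (1 + exp (3 / 2 * \<mu>\<^sup>2) / m) / m"
    by (simp add: K_def exp_add[symmetric])
  finally show ?thesis unfolding m_def .
qed

subsection \<open>Bayes risk of a single spike\<close>

lemma measurable_noise_cong: "measurable (noise n) N = measurable (Rn n) N"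
proof -
  have "sets (noise n) = sets (Rn n)"
    unfolding noise_def by (rule sets_PiM_cong) auto
  then show ?thesis
    by (auto cong: measurable_cong_sets)
qed

lemma measurable_obs_map:
  "(\<lambda>z. \<lambda>i\<in>{1..n}. \<theta> i + \<sigma> * z i) \<in> measurable (noise n) (Rn n)"
  unfolding measurable_noise_cong by measurable

lemma nn_integral_obs_law:
  assumes "f \<in> borel_measurable (Rn n)"
  shows "(\<integral>\<^sup>+y. f y \<partial>obs_law n \<sigma> \<theta>) = (\<integral>\<^sup>+z. f (\<lambda>i\<in>{1..n}. \<theta> i + \<sigma> * z i) \<partial>noise n)"
  unfolding obs_law_def using assms by (intro nn_integral_distr measurable_obs_map) auto

lemma estimator_component:
  assumes "est \<in> estimators n" "i \<in> {1..n}"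
  shows "(\<lambda>y. est y i) \<in> borel_measurable (Rn n)"
  using measurable_compose[OF assms(1)[unfolded estimators_def] measurable_component_singleton[OF assms(2)]] .

text \<open>Only the loss is restricted to \<open>L\<close>; the estimator still sees the whole
  observation, so the other coordinates act as side information.\<close>

definition block_risk ::
  "nat \<Rightarrow> real \<Rightarrow> nat set \<Rightarrow> ((nat \<Rightarrow> real) \<Rightarrow> (nat \<Rightarrow> real)) \<Rightarrow> (nat \<Rightarrow> real) \<Rightarrow> ennreal" where
  "block_risk n \<sigma> L est \<theta> = (\<integral>\<^sup>+y. ennreal (\<Sum>j\<in>L. (est y j - \<theta> j)\<^sup>2) \<partial>obs_law n \<sigma> \<theta>)"

text \<open>Relative to the law without a spike in the block, a spike \<open>s \<tau>\<close> at coordinate \<open>l\<close> has density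
  \<open>exp (s \<mu> z\<^sub>l - \<mu>\<^sup>2/2)\<close>. Averaging over \<open>s\<close> produces \<open>spike_cosh\<close> and \<open>spike_sinh\<close>, and
  completing the square pointwise in the estimate bounds the posterior risk from below.\<close>

lemma posterior_risk_bound:
  fixes e z :: "nat \<Rightarrow> real"
  assumes L: "finite L" "L \<noteq> {}"
  shows "2 * \<tau>\<^sup>2 * (\<Sum>l\<in>L. spike_cosh \<mu> (z l)) \<le>
      (\<Sum>(l, s)\<in>L \<times> {1, -1}. exp (s * \<mu> * z l - (s * \<mu>)\<^sup>2 / 2) * (\<Sum>j\<in>L. (e j - ((\<lambda>_. 0)(l := s * \<tau>)) j)\<^sup>2))
      + (\<Sum>j\<in>L. 2 * \<tau>\<^sup>2 * ((spike_sinh \<mu> (z j))\<^sup>2 / (\<Sum>l\<in>L. spike_cosh \<mu> (z l))))"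
proof -
  define C where "C = (\<Sum>l\<in>L. spike_cosh \<mu> (z l))"
  have C: "C > 0" unfolding C_def using L by (intro sum_pos spike_cosh_pos)
  \<comment> \<open>A spike vector is nonzero only at \<open>l\<close>, so its loss differs from
    that of the zero vector in one coordinate.\<close>
  have split: "(\<Sum>j\<in>L. (e j - ((\<lambda>_. 0)(l := s * \<tau>)) j)\<^sup>2)
      = (\<Sum>j\<in>L. (e j)\<^sup>2) - 2 * s * \<tau> * e l + (s * \<tau>)\<^sup>2" if "l \<in> L" for l s
  proof -
    have "(e j - ((\<lambda>_. 0)(l := s * \<tau>)) j)\<^sup>2 = (e j)\<^sup>2 + (if j = l then - 2 * s * \<tau> * e l + (s * \<tau>)\<^sup>2 else 0)" for j
      by (simp add: power2_diff)
    then show ?thesis using that L by (simp add: sum.distrib)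
  qed
  have w1: "exp (\<mu> * x - \<mu>\<^sup>2 / 2) + exp (- \<mu> * x - \<mu>\<^sup>2 / 2) = 2 * spike_cosh \<mu> x" for x
    unfolding diff_conv_add_uminus exp_add spike_cosh_def cosh_def by (simp add: algebra_simps)
  have w2: "exp (\<mu> * x - \<mu>\<^sup>2 / 2) - exp (- \<mu> * x - \<mu>\<^sup>2 / 2) = 2 * spike_sinh \<mu> x" for x
    unfolding diff_conv_add_uminus exp_add spike_sinh_def sinh_def by (simp add: algebra_simps)
  have "(\<Sum>(l, s)\<in>L \<times> {1, -1}. exp (s * \<mu> * z l - (s * \<mu>)\<^sup>2 / 2) * (\<Sum>j\<in>L. (e j - ((\<lambda>_. 0)(l := s * \<tau>)) j)\<^sup>2))
      = (\<Sum>l\<in>L. exp (\<mu> * z l - \<mu>\<^sup>2 / 2) * ((\<Sum>j\<in>L. (e j)\<^sup>2) - 2 * \<tau> * e l + \<tau>\<^sup>2)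
             + exp (- \<mu> * z l - \<mu>\<^sup>2 / 2) * ((\<Sum>j\<in>L. (e j)\<^sup>2) + 2 * \<tau> * e l + \<tau>\<^sup>2))"
    by (subst sum.cartesian_product[symmetric]) (intro sum.cong, auto simp del: fun_upd_apply simp: split)
  also have "\<dots> = (\<Sum>l\<in>L. (exp (\<mu> * z l - \<mu>\<^sup>2 / 2) + exp (- \<mu> * z l - \<mu>\<^sup>2 / 2)) * ((\<Sum>j\<in>L. (e j)\<^sup>2) + \<tau>\<^sup>2)
             - (exp (\<mu> * z l - \<mu>\<^sup>2 / 2) - exp (- \<mu> * z l - \<mu>\<^sup>2 / 2)) * (2 * \<tau> * e l))"
    by (intro sum.cong) (auto simp: algebra_simps)
  also have "\<dots> = 2 * C * ((\<Sum>j\<in>L. (e j)\<^sup>2) + \<tau>\<^sup>2) - (\<Sum>l\<in>L. 2 * spike_sinh \<mu> (z l) * (2 * \<tau> * e l))"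
    unfolding w1 w2 C_def by (simp only: sum_subtractf sum_distrib_right[symmetric] sum_distrib_left[symmetric])
  also have "\<dots> = 2 * \<tau>\<^sup>2 * C + (\<Sum>l\<in>L. 2 * C * (e l)\<^sup>2 - 4 * \<tau> * (spike_sinh \<mu> (z l) * e l))"
    by (simp add: sum_subtractf sum_distrib_left algebra_simps)
  finally have S: "(\<Sum>(l, s)\<in>L \<times> {1, -1}. exp (s * \<mu> * z l - (s * \<mu>)\<^sup>2 / 2) * (\<Sum>j\<in>L. (e j - ((\<lambda>_. 0)(l := s * \<tau>)) j)\<^sup>2))
      = 2 * \<tau>\<^sup>2 * C + (\<Sum>l\<in>L. 2 * C * (e l)\<^sup>2 - 4 * \<tau> * (spike_sinh \<mu> (z l) * e l))" .
  \<comment> \<open>The square vanishes at \<open>x = \<tau> * v / C\<close>, which for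
    \<open>v = spike_sinh \<mu> (z l)\<close> is the posterior mean of coordinate
    \<open>l\<close>.\<close>
  have sq: "0 \<le> (2 * C * x\<^sup>2 - 4 * \<tau> * (v * x)) + 2 * \<tau>\<^sup>2 * (v\<^sup>2 / C)" for x v
  proof -
    have "(2 * C * x\<^sup>2 - 4 * \<tau> * (v * x)) + 2 * \<tau>\<^sup>2 * (v\<^sup>2 / C) = 2 / C * (C * x - \<tau> * v)\<^sup>2"
      using C by (simp add: field_simps power2_eq_square)
    then show ?thesis using C by simp
  qed
  have "0 \<le> (\<Sum>l\<in>L. 2 * C * (e l)\<^sup>2 - 4 * \<tau> * (spike_sinh \<mu> (z l) * e l))
       + (\<Sum>j\<in>L. 2 * \<tau>\<^sup>2 * ((spike_sinh \<mu> (z j))\<^sup>2 / C))"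
    unfolding sum.distrib[symmetric] by (intro sum_nonneg sq)
  then show ?thesis unfolding S C_def[symmetric] by simp
qed

text \<open>Numerator and denominator share coordinate \<open>j\<close>. Dropping its positive term
  from the denominator only increases the ratio and makes the two independent; this costs one
  coordinate, hence \<open>card L - 1\<close> and the need for two coordinates in the block.\<close>

lemma nn_integral_posterior_correction:
  assumes L: "L \<subseteq> {1..n}" "j \<in> L" "2 \<le> card L"
  shows "(\<integral>\<^sup>+z. ennreal ((spike_sinh \<mu> (z j))\<^sup>2 / (\<Sum>l\<in>L. spike_cosh \<mu> (z l))) \<partial>noise n)
    \<le> ennreal (exp (\<mu>\<^sup>2) / 2 * ((1 + exp (3 / 2 * \<mu>\<^sup>2) / real (card L - 1)) / real (card L - 1)))"
proof -
  have fL: "finite L" using L finite_subset by blast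
  have c: "card (L - {j}) = card L - 1" using L fL by simp
  have ne: "L - {j} \<noteq> {}"
  proof
    assume "L - {j} = {}"
    with c L show False by simp
  qed
  have [measurable]: "(\<lambda>z. z l) \<in> borel_measurable (noise n)" if "l \<in> L" for l
    unfolding measurable_noise_cong using that L by auto
  let ?D = "\<lambda>z. (\<Sum>l\<in>L - {j}. spike_cosh \<mu> (z l))"
  have Dm: "(\<lambda>z. ennreal (1 / ?D z)) \<in> borel_measurable (noise n)"
    by measurable
  have "(\<integral>\<^sup>+z. ennreal ((spike_sinh \<mu> (z j))\<^sup>2 / (\<Sum>l\<in>L. spike_cosh \<mu> (z l))) \<partial>noise n)
      \<le> (\<integral>\<^sup>+z. ennreal ((spike_sinh \<mu> (z j))\<^sup>2) * ennreal (1 / ?D z) \<partial>noise n)"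
  proof (intro nn_integral_mono)
    fix z :: "nat \<Rightarrow> real"
    have D: "?D z > 0" using ne fL by (intro sum_pos spike_cosh_pos) auto
    have le: "?D z \<le> (\<Sum>l\<in>L. spike_cosh \<mu> (z l))"
      using fL by (intro sum_mono2) (auto intro: less_imp_le spike_cosh_pos)
    have "(spike_sinh \<mu> (z j))\<^sup>2 / (\<Sum>l\<in>L. spike_cosh \<mu> (z l)) \<le> (spike_sinh \<mu> (z j))\<^sup>2 / ?D z"
      using D le by (intro divide_left_mono) auto
    then show "ennreal ((spike_sinh \<mu> (z j))\<^sup>2 / (\<Sum>l\<in>L. spike_cosh \<mu> (z l)))
        \<le> ennreal ((spike_sinh \<mu> (z j))\<^sup>2) * ennreal (1 / ?D z)"
      using D by (simp add: ennreal_mult[symmetric] ennreal_leI)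
  qed
  also have "\<dots> = (\<integral>\<^sup>+x. ennreal ((spike_sinh \<mu> x)\<^sup>2) \<partial>std_normal_distribution)
      * (\<integral>\<^sup>+z. ennreal (1 / ?D z) \<partial>noise n)"
    unfolding noise_def
    by (rule nn_integral_PiM_factor[OF prob_space_std_normal, of "{1..n}" j "\<lambda>x. ennreal ((spike_sinh \<mu> x)\<^sup>2)"])
       (use L Dm in \<open>auto simp: noise_def\<close>)
  also have "\<dots> \<le> ennreal (exp (\<mu>\<^sup>2) / 2) *
      ennreal ((1 + exp (3 / 2 * \<mu>\<^sup>2) / real (card (L - {j}))) / real (card (L - {j})))"
    unfolding noise_def using L ne
    by (intro mult_mono nn_integral_spike_sinh_sq nn_integral_inverse_sum_spike_cosh) auto
  also have "\<dots> = ennreal (exp (\<mu>\<^sup>2) / 2 * ((1 + exp (3 / 2 * \<mu>\<^sup>2) / real (card L - 1)) / real (card L - 1)))"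
    unfolding c by (intro ennreal_mult[symmetric]) auto
  finally show ?thesis .
qed

text \<open>The uniform prior on the \<open>2 * card L\<close> signed spikes is left unnormalised,
  and the correction is added on the right to avoid truncated subtraction. Outside \<open>L\<close>
  the vector \<open>\<theta>\<close> is arbitrary, so the bound applies with the other blocks
  frozen.\<close>

lemma single_spike_bayes_risk:
  fixes \<mu> \<sigma> :: real and L :: "nat set"
  assumes est: "est \<in> estimators n" and L: "L \<subseteq> {1..n}" "2 \<le> card L"
    and \<theta>: "\<And>l. l \<in> L \<Longrightarrow> \<theta> l = 0"
  defines "q \<equiv> exp (\<mu>\<^sup>2) / 2 * ((1 + exp (3 / 2 * \<mu>\<^sup>2) / real (card L - 1)) / real (card L - 1))"
  shows "ennreal (2 * (\<sigma> * \<mu>)\<^sup>2 * real (card L)) \<le>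
     (\<Sum>(l, s)\<in>L \<times> {1, -1}. block_risk n \<sigma> L est (\<theta>(l := s * (\<sigma> * \<mu>))))
     + ennreal (2 * (\<sigma> * \<mu>)\<^sup>2 * real (card L) * q)"
proof -
  let ?\<tau> = "\<sigma> * \<mu>"
  have fL: "finite L" using L finite_subset by blast
  have ne: "L \<noteq> {}" using L by auto
  have zm[measurable]: "(\<lambda>z. z l) \<in> borel_measurable (noise n)" if "l \<in> L" for l
    unfolding measurable_noise_cong using that L by auto
  define Y where "Y z = (\<lambda>i\<in>{1..n}. \<theta> i + \<sigma> * z i)" for z
  have Ym: "Y \<in> measurable (noise n) (Rn n)"
    unfolding Y_def[abs_def] by (rule measurable_obs_map)
  have em[measurable]: "(\<lambda>z. est (Y z) j) \<in> borel_measurable (noise n)" if "j \<in> L" for j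
    using measurable_compose[OF Ym estimator_component[OF est]] that L by auto
  let ?loss = "\<lambda>l s z. (\<Sum>j\<in>L. (est (Y z) j - ((\<lambda>_. 0)(l := s * ?\<tau>)) j)\<^sup>2)"
  let ?w = "\<lambda>l s z. exp (s * \<mu> * z l - (s * \<mu>)\<^sup>2 / 2)"
  have lossm: "(\<lambda>z. ennreal (?loss l s z)) \<in> borel_measurable (noise n)" for l s
    by measurable
  have wlm: "(\<lambda>z. ?w l s z * ?loss l s z) \<in> borel_measurable (noise n)" if "l \<in> L" for l s
    using that by measurable
  have risk: "block_risk n \<sigma> L est (\<theta>(l := s * ?\<tau>)) = (\<integral>\<^sup>+z. ennreal (?w l s z * ?loss l s z) \<partial>noise n)"
    if "l \<in> L" for l s
  proof -
    have [measurable]: "(\<lambda>y. est y j) \<in> borel_measurable (Rn n)" if "j \<in> L" for j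
      using estimator_component[OF est] that L by auto
    have "block_risk n \<sigma> L est (\<theta>(l := s * ?\<tau>))
        = (\<integral>\<^sup>+z. ennreal (\<Sum>j\<in>L. (est (\<lambda>i\<in>{1..n}. (\<theta>(l := s * ?\<tau>)) i + \<sigma> * z i) j - (\<theta>(l := s * ?\<tau>)) j)\<^sup>2) \<partial>noise n)"
      unfolding block_risk_def by (rule nn_integral_obs_law) measurable
    also have "\<dots> = (\<integral>\<^sup>+z. ennreal (?loss l s (z(l := z l + s * \<mu>))) \<partial>noise n)"
    proof (intro nn_integral_cong arg_cong[where f = ennreal] sum.cong refl)
      fix z j assume "j \<in> L"
      \<comment> \<open>Since the noise has scale \<sigma>, a spike
        \<open>s * (\<sigma> * \<mu>)\<close> in the mean equals a shift of one noise coordinate by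
        \<open>s * \<mu>\<close>. This is what the Gaussian shift formula then removes.\<close>
      have "(\<lambda>i\<in>{1..n}. (\<theta>(l := s * ?\<tau>)) i + \<sigma> * z i) = Y (z(l := z l + s * \<mu>))"
        using \<theta>[OF \<open>l \<in> L\<close>] by (auto simp: Y_def fun_eq_iff restrict_def algebra_simps)
      then show "(est (\<lambda>i\<in>{1..n}. (\<theta>(l := s * ?\<tau>)) i + \<sigma> * z i) j - (\<theta>(l := s * ?\<tau>)) j)\<^sup>2
          = (est (Y (z(l := z l + s * \<mu>))) j - ((\<lambda>_. 0)(l := s * ?\<tau>)) j)\<^sup>2"
        using \<theta>[OF \<open>j \<in> L\<close>] by simp
    qed
    also have "\<dots> = (\<integral>\<^sup>+z. ennreal (?w l s z) * ennreal (?loss l s z) \<partial>noise n)"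
      unfolding noise_def
      by (rule nn_integral_PiM_std_normal_shift[of "{1..n}" l "\<lambda>z. ennreal (?loss l s z)"])
         (use that L lossm in \<open>auto simp: noise_def\<close>)
    finally show ?thesis
      by (simp add: ennreal_mult[symmetric] sum_nonneg)
  qed
  have sumrisk: "(\<Sum>(l, s)\<in>L \<times> {1, -1}. block_risk n \<sigma> L est (\<theta>(l := s * ?\<tau>)))
      = (\<integral>\<^sup>+z. ennreal (\<Sum>(l, s)\<in>L \<times> {1, -1}. ?w l s z * ?loss l s z) \<partial>noise n)"
  proof -
    have "(\<Sum>(l, s)\<in>L \<times> {1, -1}. block_risk n \<sigma> L est (\<theta>(l := s * ?\<tau>)))
        = (\<Sum>p\<in>L \<times> {1, -1}. \<integral>\<^sup>+z. ennreal (?w (fst p) (snd p) z * ?loss (fst p) (snd p) z) \<partial>noise n)"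
    proof (intro sum.cong refl)
      fix p :: "nat \<times> real" assume "p \<in> L \<times> {1, -1}"
      then have "fst p \<in> L" by auto
      from risk[OF this, of "snd p"]
      show "(case p of (l, s) \<Rightarrow> block_risk n \<sigma> L est (\<theta>(l := s * ?\<tau>)))
          = (\<integral>\<^sup>+z. ennreal (?w (fst p) (snd p) z * ?loss (fst p) (snd p) z) \<partial>noise n)"
        by (simp only: case_prod_unfold)
    qed
    also have "\<dots> = (\<integral>\<^sup>+z. (\<Sum>p\<in>L \<times> {1, -1}. ennreal (?w (fst p) (snd p) z * ?loss (fst p) (snd p) z)) \<partial>noise n)"
      by (rule nn_integral_sum[symmetric]) (auto simp del: fun_upd_apply intro!: measurable_compose[OF wlm])
    finally show ?thesis
      by (simp add: case_prod_unfold sum_nonneg)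
  qed
  let ?C = "\<lambda>z. (\<Sum>l\<in>L. spike_cosh \<mu> (z l))"
  have EC: "(\<integral>\<^sup>+z. ennreal (2 * ?\<tau>\<^sup>2 * ?C z) \<partial>noise n) = ennreal (2 * ?\<tau>\<^sup>2 * real (card L))"
  proof -
    have "(\<integral>\<^sup>+z. ennreal (2 * ?\<tau>\<^sup>2 * ?C z) \<partial>noise n)
        = (\<integral>\<^sup>+z. ennreal (2 * ?\<tau>\<^sup>2) * (\<Sum>l\<in>L. ennreal (spike_cosh \<mu> (z l))) \<partial>noise n)"
      by (intro nn_integral_cong) (simp add: ennreal_mult sum_nonneg less_imp_le[OF spike_cosh_pos])
    also have "\<dots> = ennreal (2 * ?\<tau>\<^sup>2) * (\<Sum>l\<in>L. \<integral>\<^sup>+z. ennreal (spike_cosh \<mu> (z l)) \<partial>noise n)"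
      by (subst nn_integral_cmult, simp, subst nn_integral_sum) simp_all
    also have "(\<Sum>l\<in>L. \<integral>\<^sup>+z. ennreal (spike_cosh \<mu> (z l)) \<partial>noise n) = (\<Sum>l\<in>L. 1)"
    proof (intro sum.cong refl)
      fix l assume "l \<in> L"
      then show "(\<integral>\<^sup>+z. ennreal (spike_cosh \<mu> (z l)) \<partial>noise n) = 1"
        using nn_integral_PiM_component[OF prob_space_std_normal, of "{1..n}" l "\<lambda>x. ennreal (spike_cosh \<mu> x)"] L
        by (auto simp: noise_def nn_integral_spike_cosh)
    qed
    finally show ?thesis
      by (simp add: ennreal_mult ennreal_of_nat_eq_real_of_nat)
  qed
  let ?Q = "\<lambda>z. (\<Sum>j\<in>L. 2 * ?\<tau>\<^sup>2 * ((spike_sinh \<mu> (z j))\<^sup>2 / ?C z))"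
  have C0: "0 \<le> ?C z" for z by (intro sum_nonneg less_imp_le[OF spike_cosh_pos])
  have EQ: "(\<integral>\<^sup>+z. ennreal (?Q z) \<partial>noise n) \<le> ennreal (2 * ?\<tau>\<^sup>2 * real (card L) * q)"
  proof -
    have "(\<integral>\<^sup>+z. ennreal (?Q z) \<partial>noise n)
        = (\<integral>\<^sup>+z. ennreal (2 * ?\<tau>\<^sup>2) * (\<Sum>j\<in>L. ennreal ((spike_sinh \<mu> (z j))\<^sup>2 / ?C z)) \<partial>noise n)"
      by (intro nn_integral_cong)
         (simp only: sum_distrib_left[symmetric] ennreal_mult sum_nonneg C0 divide_nonneg_nonneg
            zero_le_power2 zero_le_mult_iff zero_le_numeral sum_ennreal simp_thms)
    also have "\<dots> = ennreal (2 * ?\<tau>\<^sup>2) * (\<Sum>j\<in>L. \<integral>\<^sup>+z. ennreal ((spike_sinh \<mu> (z j))\<^sup>2 / ?C z) \<partial>noise n)"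
      by (subst nn_integral_cmult, simp, subst nn_integral_sum) simp_all
    also have "\<dots> \<le> ennreal (2 * ?\<tau>\<^sup>2) * (\<Sum>j\<in>L. ennreal q)"
      unfolding q_def by (intro mult_left_mono sum_mono nn_integral_posterior_correction L) auto
    also have "\<dots> = ennreal (2 * ?\<tau>\<^sup>2 * real (card L) * q)"
    proof -
      have "0 \<le> q" by (simp add: q_def)
      then show ?thesis
        by (simp add: ennreal_mult ennreal_of_nat_eq_real_of_nat mult.assoc)
    qed
    finally show ?thesis .
  qed
  have "ennreal (2 * ?\<tau>\<^sup>2 * real (card L))
      \<le> (\<integral>\<^sup>+z. ennreal (\<Sum>(l, s)\<in>L \<times> {1, -1}. ?w l s z * ?loss l s z) + ennreal (?Q z) \<partial>noise n)"
    unfolding EC[symmetric]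
  proof (intro nn_integral_mono)
    fix z
    have "ennreal (2 * ?\<tau>\<^sup>2 * ?C z) \<le> ennreal ((\<Sum>(l, s)\<in>L \<times> {1, -1}. ?w l s z * ?loss l s z) + ?Q z)"
      by (intro ennreal_leI posterior_risk_bound fL ne)
    also have "\<dots> = ennreal (\<Sum>(l, s)\<in>L \<times> {1, -1}. ?w l s z * ?loss l s z) + ennreal (?Q z)"
      by (intro ennreal_plus sum_nonneg) (auto simp: C0 sum_nonneg)
    finally show "ennreal (2 * ?\<tau>\<^sup>2 * ?C z)
        \<le> ennreal (\<Sum>(l, s)\<in>L \<times> {1, -1}. ?w l s z * ?loss l s z) + ennreal (?Q z)" .
  qed
  also have "\<dots> = (\<Sum>(l, s)\<in>L \<times> {1, -1}. block_risk n \<sigma> L est (\<theta>(l := s * ?\<tau>))) + (\<integral>\<^sup>+z. ennreal (?Q z) \<partial>noise n)"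
    unfolding sumrisk
  proof (rule nn_integral_add)
    show "(\<lambda>z. ennreal (\<Sum>(l, s)\<in>L \<times> {1, -1}. ?w l s z * ?loss l s z)) \<in> borel_measurable (noise n)"
      unfolding case_prod_unfold
      by (rule measurable_compose[OF borel_measurable_sum measurable_ennreal], rule wlm) auto
  qed measurable
  also have "\<dots> \<le> (\<Sum>(l, s)\<in>L \<times> {1, -1}. block_risk n \<sigma> L est (\<theta>(l := s * ?\<tau>))) + ennreal (2 * ?\<tau>\<^sup>2 * real (card L) * q)"
    by (intro add_left_mono EQ)
  finally show ?thesis .
qed

subsection \<open>Independent spikes in disjoint blocks\<close>

text \<open>A finite Fubini rule: a sum over all spike configurations is taken over one block
  inside, with the others frozen.\<close>

lemma sum_PiE_split:
  assumes "finite K" "b \<in> K" "\<And>i. i \<in> K \<Longrightarrow> finite (A i)"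
  shows "(\<Sum>x\<in>PiE K A. F x) = (\<Sum>g\<in>PiE (K - {b}) A. \<Sum>a\<in>A b. F (g(b := a)))"
proof -
  have ins: "insert b (K - {b}) = K" using assms by auto
  have "PiE K A = (\<lambda>(a, g). g(b := a)) ` (A b \<times> PiE (K - {b}) A)"
    using PiE_insert_eq[of b "K - {b}" A] unfolding ins .
  moreover have "inj_on (\<lambda>(a, g). g(b := a)) (A b \<times> PiE (K - {b}) A)"
    by (rule inj_combinator) simp
  ultimately have "(\<Sum>x\<in>PiE K A. F x) = (\<Sum>(a, g)\<in>A b \<times> PiE (K - {b}) A. F (g(b := a)))"
    by (simp add: sum.reindex case_prod_unfold)
  also have "\<dots> = (\<Sum>g\<in>PiE (K - {b}) A. \<Sum>a\<in>A b. F (g(b := a)))"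
    by (subst sum.cartesian_product[symmetric]) (rule sum.swap)
  finally show ?thesis .
qed

text \<open>Disjoint blocks count each coordinate at most once, and the coordinates outside them
  only add nonnegative loss.\<close>

lemma sq_risk_ge_sum_block_risk:
  assumes est: "est \<in> estimators n"
    and L: "\<And>b. b \<in> K \<Longrightarrow> L b \<subseteq> {1..n}" "disjoint_family_on L K" and K: "finite K"
  shows "(\<Sum>b\<in>K. block_risk n \<sigma> (L b) est \<theta>) \<le> sq_risk n \<sigma> est \<theta>"
proof -
  have [measurable]: "(\<lambda>y. est y j) \<in> borel_measurable (Rn n)" if "j \<in> L b" "b \<in> K" for j b
    using estimator_component[OF est] that L by blast
  have so: "sets (obs_law n \<sigma> \<theta>) = sets (Rn n)" by (simp add: obs_law_def)
  have "(\<lambda>y. ennreal (\<Sum>j\<in>L b. (est y j - \<theta> j)\<^sup>2)) \<in> borel_measurable (Rn n)" if "b \<in> K" for b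
    using that by measurable
  then have m: "(\<lambda>y. ennreal (\<Sum>j\<in>L b. (est y j - \<theta> j)\<^sup>2)) \<in> borel_measurable (obs_law n \<sigma> \<theta>)"
    if "b \<in> K" for b
    using that by (simp cong: measurable_cong_sets add: measurable_cong_sets[OF so refl])
  have "(\<Sum>b\<in>K. block_risk n \<sigma> (L b) est \<theta>)
      = (\<integral>\<^sup>+y. (\<Sum>b\<in>K. ennreal (\<Sum>j\<in>L b. (est y j - \<theta> j)\<^sup>2)) \<partial>obs_law n \<sigma> \<theta>)"
    unfolding block_risk_def by (rule nn_integral_sum[symmetric]) (rule m)
  also have "\<dots> \<le> sq_risk n \<sigma> est \<theta>"
    unfolding sq_risk_def
  proof (intro nn_integral_mono)
    fix y
    have "(\<Sum>b\<in>K. \<Sum>j\<in>L b. (est y j - \<theta> j)\<^sup>2) = (\<Sum>j\<in>(\<Union>b\<in>K. L b). (est y j - \<theta> j)\<^sup>2)"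
      using K L by (intro sum.UNION_disjoint_family[symmetric]) (auto intro: finite_subset)
    also have "\<dots> \<le> l2_norm_sq n (\<lambda>i. est y i - \<theta> i)"
      unfolding l2_norm_sq_def using L by (intro sum_mono2) auto
    finally show "(\<Sum>b\<in>K. ennreal (\<Sum>j\<in>L b. (est y j - \<theta> j)\<^sup>2)) \<le> ennreal (l2_norm_sq n (\<lambda>i. est y i - \<theta> i))"
      by (simp add: sum_nonneg ennreal_leI)
  qed
  finally show ?thesis .
qed

text \<open>The pair \<open>x b\<close> holds position and sign of the spike of block
  \<open>b\<close>. With positions in disjoint blocks at most one summand is nonzero at each index,
  and changing \<open>x\<close> in one block alters only the spike of that block.\<close>

definition spike_vector :: "nat \<Rightarrow> nat \<Rightarrow> real \<Rightarrow> (nat \<Rightarrow> nat \<times> real) \<Rightarrow> nat \<Rightarrow> real" where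
  "spike_vector n k \<tau> x = (\<lambda>i\<in>{1..n}. \<Sum>b<k. if fst (x b) = i then snd (x b) * \<tau> else 0)"

text \<open>Disjointness keeps spikes from colliding, so every entry is zero or \<plusminus>\<tau>
  and at most \<open>k\<close> entries are nonzero.\<close>

lemma spike_vector_in_sparse_ball:
  assumes L: "disjoint_family_on L {..<k}" and x: "x \<in> PiE {..<k} (\<lambda>b. L b \<times> {1, -1})"
  shows "spike_vector n k \<tau> x \<in> sparse_ball n k \<tau>"
proof -
  let ?\<theta> = "spike_vector n k \<tau> x"
  let ?S = "(\<lambda>b. fst (x b)) ` {..<k}"
  have mem: "fst (x b) \<in> L b" "snd (x b) \<in> {1, -1}" if "b < k" for b
    using x that by (auto simp: PiE_iff mem_Times_iff)
  have zero: "?\<theta> i = 0" if "i \<in> {1..n}" "i \<notin> ?S" for i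
    using that by (auto simp: spike_vector_def intro!: sum.neutral)
  have le: "(?\<theta> i)\<^sup>2 \<le> \<tau>\<^sup>2" if i: "i \<in> {1..n}" for i
  proof (cases "i \<in> ?S")
    case True
    then obtain b where b: "b < k" "i = fst (x b)" by auto
    \<comment> \<open>An index belongs to at most one block, so a single summand survives.\<close>
    have "fst (x b') = i \<longleftrightarrow> b' = b" if "b' < k" for b'
      using b that mem[of b] mem[of b'] L unfolding disjoint_family_on_def by fastforce
    then have "?\<theta> i = (\<Sum>b'<k. if b' = b then snd (x b) * \<tau> else 0)"
      using i by (simp add: spike_vector_def)
    then show ?thesis using b mem[of b] by auto
  qed (use i zero in auto)
  have card: "card ?S \<le> k" using card_image_le[of "{..<k}"] by auto
  have "l0_norm n ?\<theta> \<le> card ?S"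
    unfolding l0_norm_def by (intro card_mono) (use zero in auto)
  moreover have "l2_norm_sq n ?\<theta> \<le> real k * \<tau>\<^sup>2"
  proof -
    have "l2_norm_sq n ?\<theta> \<le> (\<Sum>i\<in>{1..n}. if i \<in> ?S then \<tau>\<^sup>2 else 0)"
      unfolding l2_norm_sq_def using le zero by (intro sum_mono) auto
    also have "\<dots> = real (card ({1..n} \<inter> ?S)) * \<tau>\<^sup>2"
      by (simp add: sum.inter_restrict[symmetric])
    also have "\<dots> \<le> real k * \<tau>\<^sup>2"
      using card card_mono[of ?S "{1..n} \<inter> ?S"] by (intro mult_right_mono) auto
    finally show ?thesis .
  qed
  ultimately show ?thesis
    using card by (auto simp: sparse_ball_def spike_vector_def)
qed

text \<open>The supremum dominates the average over all configurations in \<open>X\<close>. Block by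
  block this average is bounded with the other spikes frozen, and the block risks add up to at most
  the full risk.\<close>

lemma sup_risk_lower_bound:
  fixes \<mu> \<sigma> :: real and n k m :: nat
  assumes est: "est \<in> estimators n" and m: "2 \<le> m" and kmn: "k * m \<le> n"
  defines "q \<equiv> exp (\<mu>\<^sup>2) / 2 * ((1 + exp (3 / 2 * \<mu>\<^sup>2) / real (m - 1)) / real (m - 1))"
  shows "ennreal (real k * (\<sigma> * \<mu>)\<^sup>2)
      \<le> sup_risk n \<sigma> (sparse_ball n k (\<sigma> * \<mu>)) est + ennreal (real k * (\<sigma> * \<mu>)\<^sup>2 * q)"
proof -
  let ?\<tau> = "\<sigma> * \<mu>"
  have q: "0 \<le> q" by (simp add: q_def)
  define L where "L b = {b * m + 1..b * m + m}" for b :: nat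
  define A where "A b = L b \<times> {1, -1 :: real}" for b
  define X where "X = PiE {..<k} A"
  let ?\<theta> = "spike_vector n k ?\<tau>"
  have L_sub: "L b \<subseteq> {1..n}" if "b < k" for b
  proof -
    have "b * m + m \<le> k * m" using that mult_le_mono1[of "Suc b" k m] by simp
    with kmn show ?thesis by (auto simp: L_def)
  qed
  have L_card: "card (L b) = m" for b by (simp add: L_def)
  have L_disj: "disjoint_family_on L {..<k}"
  proof -
    have "a = b" if "i \<in> L a" "i \<in> L b" for a b i
    proof -
      \<comment> \<open>The block number is recovered by division; the shift by one comes from
        indices starting at 1.\<close>
      have *: "(i - 1) div m = a" if "i \<in> L a" for a
      proof -
        have "i - 1 = a * m + (i - 1 - a * m)" "i - 1 - a * m < m"
          using that m by (auto simp: L_def)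
        then show ?thesis by (metis add.commute div_less div_mult_self1 less_zeroE add_0_right)
      qed
      then show ?thesis using that by blast
    qed
    then show ?thesis unfolding disjoint_family_on_def by blast
  qed
  have A_fin: "finite (A b)" and A_card: "card (A b) = 2 * m" for b
    by (simp_all add: A_def L_def card_cartesian_product)
  have X_fin: "finite X" unfolding X_def by (intro finite_PiE) (auto simp: A_fin)
  have X_card: "card X = (2 * m) ^ k" unfolding X_def by (simp add: card_PiE A_card)
  have ball: "?\<theta> x \<in> sparse_ball n k ?\<tau>" if "x \<in> X" for x
    using that L_disj unfolding X_def A_def by (intro spike_vector_in_sparse_ball)
  have block: "of_nat (card X) * ennreal (?\<tau>\<^sup>2)
      \<le> (\<Sum>x\<in>X. block_risk n \<sigma> (L b) est (?\<theta> x)) + of_nat (card X) * ennreal (?\<tau>\<^sup>2 * q)" if b: "b < k" for b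
  proof -
    let ?G = "PiE ({..<k} - {b}) A"
    have "card ?G = (2 * m) ^ (k - 1)"
      using b by (subst card_PiE) (auto simp: A_card)
    then have cX: "card X = card ?G * (2 * m)"
      using b by (simp add: X_card power_eq_if)
    have G: "ennreal (2 * ?\<tau>\<^sup>2 * real m) \<le>
        (\<Sum>a\<in>A b. block_risk n \<sigma> (L b) est (?\<theta> (g(b := a)))) + ennreal (2 * ?\<tau>\<^sup>2 * real m * q)"
      if g: "g \<in> ?G" for g
    proof -
      define \<theta>0 where "\<theta>0 = (\<lambda>i\<in>{1..n}. \<Sum>b'\<in>{..<k} - {b}. if fst (g b') = i then snd (g b') * ?\<tau> else 0)"
      have \<theta>0: "\<theta>0 l = 0" if "l \<in> L b" for l
      proof -
        have "fst (g b') \<noteq> l" if "b' \<in> {..<k} - {b}" for b'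
        proof -
          have "fst (g b') \<in> L b'" using PiE_mem[OF g that] by (auto simp: A_def)
          then show ?thesis
            using \<open>l \<in> L b\<close> L_disj that b unfolding disjoint_family_on_def by fastforce
        qed
        then show ?thesis using L_sub[OF b] that by (auto simp: \<theta>0_def intro!: sum.neutral)
      qed
      have upd: "?\<theta> (g(b := (l, s))) = \<theta>0(l := s * ?\<tau>)" if l: "l \<in> L b" for l s
      proof
        fix i
        have k: "{..<k} = insert b ({..<k} - {b})" using b by auto
        have sum: "(\<Sum>b'<k. if fst ((g(b := (l, s))) b') = i then snd ((g(b := (l, s))) b') * ?\<tau> else 0)
            = (if l = i then s * ?\<tau> else 0) + (\<Sum>b'\<in>{..<k} - {b}. if fst (g b') = i then snd (g b') * ?\<tau> else 0)"
          by (subst k, subst sum.insert) (simp_all, intro sum.cong, auto)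
        show "?\<theta> (g(b := (l, s))) i = (\<theta>0(l := s * ?\<tau>)) i"
          using \<theta>0[OF l] L_sub[OF b] l sum by (auto simp: spike_vector_def \<theta>0_def)
      qed
      have "(\<Sum>a\<in>A b. block_risk n \<sigma> (L b) est (?\<theta> (g(b := a))))
          = (\<Sum>(l, s)\<in>L b \<times> {1, -1}. block_risk n \<sigma> (L b) est (\<theta>0(l := s * ?\<tau>)))"
        unfolding A_def by (intro sum.cong refl) (auto simp only: upd split: prod.split)
      then show ?thesis
        using single_spike_bayes_risk[OF est L_sub[OF b], of \<theta>0 \<sigma> \<mu>] m \<theta>0
        unfolding L_card q_def by simp
    qed
    \<comment> \<open>Every frozen \<open>g\<close> extends to \<open>2 * m\<close> configurations,
      which matches the unnormalised prior in \<open>G\<close>.\<close>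
    have "of_nat (card X) * ennreal (?\<tau>\<^sup>2) = (\<Sum>g\<in>?G. ennreal (2 * ?\<tau>\<^sup>2 * real m))"
      by (simp add: cX ennreal_of_nat_eq_real_of_nat ennreal_mult[symmetric] algebra_simps)
    also have "\<dots> \<le> (\<Sum>g\<in>?G. (\<Sum>a\<in>A b. block_risk n \<sigma> (L b) est (?\<theta> (g(b := a))))
        + ennreal (2 * ?\<tau>\<^sup>2 * real m * q))"
      by (intro sum_mono G)
    also have "\<dots> = (\<Sum>x\<in>X. block_risk n \<sigma> (L b) est (?\<theta> x)) + of_nat (card X) * ennreal (?\<tau>\<^sup>2 * q)"
      unfolding sum.distrib X_def using b q
      by (subst sum_PiE_split[of "{..<k}" b A])
         (auto simp: A_fin cX[unfolded X_def] ennreal_of_nat_eq_real_of_nat ennreal_mult[symmetric] algebra_simps)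
    finally show ?thesis .
  qed
  let ?R = "sup_risk n \<sigma> (sparse_ball n k ?\<tau>) est"
  have "of_nat (card X) * ennreal (real k * ?\<tau>\<^sup>2) = (\<Sum>b<k. of_nat (card X) * ennreal (?\<tau>\<^sup>2))"
    by (simp add: ennreal_of_nat_eq_real_of_nat ennreal_mult[symmetric] algebra_simps)
  also have "\<dots> \<le> (\<Sum>b<k. (\<Sum>x\<in>X. block_risk n \<sigma> (L b) est (?\<theta> x)) + of_nat (card X) * ennreal (?\<tau>\<^sup>2 * q))"
    by (intro sum_mono block) auto
  also have "\<dots> = (\<Sum>x\<in>X. \<Sum>b<k. block_risk n \<sigma> (L b) est (?\<theta> x)) + of_nat (card X) * ennreal (real k * ?\<tau>\<^sup>2 * q)"
    unfolding sum.distrib using q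
    by (subst sum.swap) (simp add: ennreal_of_nat_eq_real_of_nat ennreal_mult[symmetric] algebra_simps)
  also have "\<dots> \<le> (\<Sum>x\<in>X. ?R) + of_nat (card X) * ennreal (real k * ?\<tau>\<^sup>2 * q)"
  proof (intro add_right_mono sum_mono)
    fix x assume "x \<in> X"
    have "(\<Sum>b<k. block_risk n \<sigma> (L b) est (?\<theta> x)) \<le> sq_risk n \<sigma> est (?\<theta> x)"
      using est L_sub L_disj by (intro sq_risk_ge_sum_block_risk) auto
    also have "\<dots> \<le> ?R" unfolding sup_risk_def using ball[OF \<open>x \<in> X\<close>] by (rule SUP_upper)
    finally show "(\<Sum>b<k. block_risk n \<sigma> (L b) est (?\<theta> x)) \<le> ?R" .
  qed
  also have "\<dots> = of_nat (card X) * (?R + ennreal (real k * ?\<tau>\<^sup>2 * q))"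
    by (simp add: distrib_left)
  finally have le: "of_nat (card X) * ennreal (real k * ?\<tau>\<^sup>2)
      \<le> of_nat (card X) * (?R + ennreal (real k * ?\<tau>\<^sup>2 * q))" .
  \<comment> \<open>Sums replaced averages so far; the common factor \<open>card X\<close> cancels
    because it is neither zero nor infinite.\<close>
  have "card X \<noteq> 0" using m by (simp add: X_card)
  then have "of_nat (card X) \<noteq> (0 :: ennreal)" "of_nat (card X) \<noteq> (top :: ennreal)"
    by (simp_all add: ennreal_of_nat_eq_real_of_nat)
  with le show ?thesis by (simp add: ennreal_mult_le_mult_iff)
qed

subsection \<open>One-dimensional soft thresholding\<close>

definition soft :: "real \<Rightarrow> real \<Rightarrow> real" where
  "soft a x = sgn x * max 0 (\<bar>x\<bar> - a)"

definition tail_moment :: "nat \<Rightarrow> real \<Rightarrow> real" where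
  "tail_moment k a = (\<integral>x. (max 0 (x - a)) ^ k \<partial>std_normal_distribution)"

definition soft_mean :: "real \<Rightarrow> real \<Rightarrow> real" where
  "soft_mean a t = (\<integral>x. soft a (t + x) \<partial>std_normal_distribution)"

definition soft_square :: "real \<Rightarrow> real \<Rightarrow> real" where
  "soft_square a t = (\<integral>x. (soft a (t + x))\<^sup>2 \<partial>std_normal_distribution)"

lemma soft_eq: "0 \<le> a \<Longrightarrow> soft a x = max 0 (x - a) - max 0 (- x - a)"
  by (auto simp: soft_def sgn_if max_def)

text \<open>For nonnegative \<open>a\<close> the two hinges are never positive together, so there is
  no cross term.\<close>

lemma soft_square_eq: "0 \<le> a \<Longrightarrow> (soft a x)\<^sup>2 = (max 0 (x - a))\<^sup>2 + (max 0 (- x - a))\<^sup>2"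
  by (cases x "0 :: real" rule: linorder_cases) (auto simp: soft_def max_def power2_eq_square algebra_simps)

lemma abs_soft_le: "0 \<le> a \<Longrightarrow> \<bar>soft a x\<bar> \<le> \<bar>x\<bar>"
  by (auto simp: soft_def abs_mult sgn_if)

lemma borel_measurable_soft [measurable]: "soft a \<in> borel_measurable borel"
  unfolding soft_def[abs_def] by measurable

lemma integral_std_normal_density:
  assumes [measurable]: "f \<in> borel_measurable borel"
  shows "(\<integral>x. f x \<partial>std_normal_distribution) = (\<integral>x. std_normal_density x * f x \<partial>lborel)"
  by (subst integral_density) auto

lemma integral_std_normal_uminus:
  fixes f :: "real \<Rightarrow> real"
  assumes [measurable]: "f \<in> borel_measurable borel"
  shows "(\<integral>x. f (- x) \<partial>std_normal_distribution) = (\<integral>x. f x \<partial>std_normal_distribution)"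
proof -
  have "(\<integral>x. f x \<partial>std_normal_distribution) = (\<integral>x. std_normal_density (- x) * f (- x) \<partial>lborel)"
    by (subst integral_std_normal_density, simp, subst lborel_integral_real_affine[where c = "-1" and t = 0]) simp_all
  also have "\<dots> = (\<integral>x. f (- x) \<partial>std_normal_distribution)"
    by (subst integral_std_normal_density) (simp_all add: std_normal_density_def)
  finally show ?thesis ..
qed

lemma integrable_std_normal_poly:
  "integrable std_normal_distribution (\<lambda>x. c0 + c1 * \<bar>x\<bar> + c2 * x\<^sup>2)"
proof -
  interpret prob_space std_normal_distribution by (rule prob_space_std_normal)
  have "integrable std_normal_distribution (\<lambda>x::real. x)"
    using integrable_std_normal_distribution_moment[of 1] by simp
  then have "integrable std_normal_distribution (\<lambda>x::real. \<bar>x\<bar>)" by simp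
  moreover have "integrable std_normal_distribution (\<lambda>x::real. x\<^sup>2)"
    by (rule integrable_std_normal_distribution_moment)
  ultimately show ?thesis by simp
qed

lemma integrable_tail_1: "integrable std_normal_distribution (\<lambda>x. max 0 (x - a))"
  by (rule Bochner_Integration.integrable_bound[OF integrable_std_normal_poly[of "\<bar>a\<bar>" 1 0]]) auto

lemma integrable_tail_2: "integrable std_normal_distribution (\<lambda>x. (max 0 (x - a))\<^sup>2)"
proof (rule Bochner_Integration.integrable_bound[OF integrable_std_normal_poly[of "2 * a\<^sup>2" 0 2]])
  have "(max 0 (x - a))\<^sup>2 \<le> 2 * a\<^sup>2 + 2 * x\<^sup>2" for x
  proof -
    have "(max 0 (x - a))\<^sup>2 \<le> (x - a)\<^sup>2" by (auto simp: max_def)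
    also have "\<dots> \<le> 2 * a\<^sup>2 + 2 * x\<^sup>2" using sum_squares_bound[of x "- a"] by (simp add: power2_diff)
    finally show ?thesis .
  qed
  then show "AE x in std_normal_distribution. norm ((max 0 (x - a))\<^sup>2) \<le> norm (2 * a\<^sup>2 + 0 * \<bar>x\<bar> + 2 * x\<^sup>2)"
    by auto
qed simp

text \<open>Each hinge of \<open>soft\<close> integrates to a first tail moment; the lower one is
  reflected by symmetry of the Gaussian.\<close>

lemma soft_mean_eq:
  assumes "0 \<le> a"
  shows "soft_mean a t = tail_moment 1 (a - t) - tail_moment 1 (a + t)"
proof -
  have *: "soft a (t + x) = max 0 (x - (a - t)) - max 0 (- x - (a + t))" for x
    using soft_eq[OF assms, of "t + x"] by (simp add: algebra_simps)
  have i: "integrable std_normal_distribution (\<lambda>x. max 0 (- x - (a + t)))"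
    by (rule Bochner_Integration.integrable_bound[OF integrable_std_normal_poly[of "\<bar>a + t\<bar>" 1 0]]) auto
  show ?thesis
    unfolding soft_mean_def * tail_moment_def
    using integral_std_normal_uminus[of "\<lambda>x. max 0 (x - (a + t))"]
    by (simp add: integrable_tail_1 i)
qed

lemma soft_square_0_eq:
  assumes "0 \<le> a"
  shows "soft_square a 0 = 2 * tail_moment 2 a"
proof -
  have i: "integrable std_normal_distribution (\<lambda>x. (max 0 (- x - a))\<^sup>2)"
  proof (rule Bochner_Integration.integrable_bound[OF integrable_std_normal_poly[of 0 0 1]])
    have "(max 0 (- x - a))\<^sup>2 \<le> x\<^sup>2" for x
      using assms by (auto simp: max_def abs_le_square_iff[symmetric])
    then show "AE x in std_normal_distribution. norm ((max 0 (- x - a))\<^sup>2) \<le> norm (0 + 0 * \<bar>x\<bar> + 1 * x\<^sup>2)"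
      by auto
  qed simp
  show ?thesis
    unfolding soft_square_def tail_moment_def
    using integral_std_normal_uminus[of "\<lambda>x. (max 0 (x - a))\<^sup>2"]
    by (simp add: soft_square_eq[OF assms] integrable_tail_2 i)
qed

lemma soft_shift_sq_le: "0 \<le> a \<Longrightarrow> (soft a (t + x))\<^sup>2 \<le> 2 * t\<^sup>2 + 2 * x\<^sup>2"
proof -
  assume "0 \<le> a"
  then have "(soft a (t + x))\<^sup>2 \<le> (t + x)\<^sup>2" using abs_soft_le abs_le_square_iff by blast
  also have "\<dots> \<le> 2 * t\<^sup>2 + 2 * x\<^sup>2" using sum_squares_bound[of x t] by (simp add: power2_sum algebra_simps)
  finally show ?thesis .
qed

lemma integrable_soft:
  assumes "0 \<le> a"
  shows "integrable std_normal_distribution (\<lambda>x. soft a (t + x))"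
    and "integrable std_normal_distribution (\<lambda>x. (soft a (t + x))\<^sup>2)"
proof -
  show "integrable std_normal_distribution (\<lambda>x. soft a (t + x))"
  proof (rule Bochner_Integration.integrable_bound[OF integrable_std_normal_poly[of "\<bar>t\<bar>" 1 0]])
    have "\<bar>soft a (t + x)\<bar> \<le> \<bar>t\<bar> + \<bar>x\<bar>" for x
      using abs_soft_le[OF assms, of "t + x"] by linarith
    then show "AE x in std_normal_distribution. norm (soft a (t + x)) \<le> norm (\<bar>t\<bar> + 1 * \<bar>x\<bar> + 0 * x\<^sup>2)"
      by auto
  qed simp
  show "integrable std_normal_distribution (\<lambda>x. (soft a (t + x))\<^sup>2)"
    using soft_shift_sq_le[OF assms]
    by (intro Bochner_Integration.integrable_bound[OF integrable_std_normal_poly[of "2 * t\<^sup>2" 0 2]]) auto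
qed

lemma soft_square_nonneg: "0 \<le> soft_square a t"
  unfolding soft_square_def by simp

text \<open>Thresholding contracts towards zero. A crude constant suffices: on the spike coordinates
  the bound is multiplied by \<open>c\<^sup>2\<close> and becomes negligible.\<close>

lemma soft_square_le:
  assumes "0 \<le> a"
  shows "soft_square a t \<le> 2 * t\<^sup>2 + 2"
proof -
  interpret prob_space std_normal_distribution by (rule prob_space_std_normal)
  have x2: "integrable std_normal_distribution (\<lambda>x::real. x\<^sup>2)"
    by (rule integrable_std_normal_distribution_moment)
  have "(\<integral>x. x\<^sup>2 \<partial>std_normal_distribution) = (1 :: real)"
    using std_normal_distribution_even_moments(1)[of 1] by simp
  moreover have "soft_square a t \<le> (\<integral>x. 2 * t\<^sup>2 + 2 * x\<^sup>2 \<partial>std_normal_distribution)"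
    unfolding soft_square_def
    using x2 by (intro integral_mono integrable_soft(2) assms soft_shift_sq_le) auto
  ultimately show ?thesis using x2 prob_space by simp
qed

text \<open>The remainder of the tangent line inequality is an integral of \<open>r \<ge> 0\<close> against
  \<open>\<phi>(z) - \<phi>(2a - z)\<close>, and \<open>r\<close> vanishes right of \<open>a\<close>, where this difference is negative.\<close>

lemma soft_mean_tangent:
  assumes a: "0 \<le> a" and u: "0 \<le> u"
  obtains p where "p \<le> 2"
    "\<And>t. 0 \<le> t \<Longrightarrow> soft_mean a u + p * (t - u) \<le> soft_mean a t"
proof
  let ?N = std_normal_distribution
  interpret prob_space ?N by (rule prob_space_std_normal)
  \<comment> \<open>The slope \<open>p1 + p2\<close> is the derivative of \<open>soft_mean a\<close>
    at \<open>u\<close>. The closed half-line in \<open>p2\<close> is the exact complement of the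
    reflected open one in \<open>p1\<close>, as \<open>r_refl\<close> needs.\<close>
  define p1 :: real where "p1 = (\<integral>x. indicator {a - u<..} x \<partial>?N)"
  define p2 :: real where "p2 = (\<integral>x. indicator {a + u..} x \<partial>?N)"
  have ind: "integrable ?N (indicator A :: real \<Rightarrow> real)" if "A \<in> sets borel" for A
    using that by (intro integrable_real_indicator) (auto simp: emeasure_finite less_top[symmetric])
  have "p1 \<le> 1" "p2 \<le> 1"
    unfolding p1_def p2_def by (simp_all add: prob_le_1)
  then show "p1 + p2 \<le> 2" by simp
  fix t :: real assume t: "0 \<le> t"
  \<comment> \<open>The remainder of the tangent at \<open>u\<close> to the hinge, convex as a
    function of \<open>t\<close>. Its reflection about \<open>a\<close> is the corresponding
    remainder for the other hinge, up to sign.\<close>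
  define r where "r z = max 0 (z - (a - t)) - max 0 (z - (a - u)) - (t - u) * indicator {a - u<..} z" for z
  have [measurable]: "r \<in> borel_measurable borel" unfolding r_def[abs_def] by measurable
  have r_nonneg: "0 \<le> r z" for z
    by (auto simp: r_def indicator_def max_def)
  have r_zero: "r z = 0" if "a < z" for z
    using that t u by (auto simp: r_def indicator_def max_def)
  have r_refl: "r (2 * a - z) = max 0 (z - (a + t)) - max 0 (z - (a + u)) + (t - u) * indicator {a + u..} z" for z
    by (auto simp: r_def indicator_def max_def)
  have r_int: "integrable ?N r"
    unfolding r_def[abs_def] by (intro Bochner_Integration.integrable_diff integrable_tail_1 integrable_mult_right ind) auto
  have r'_int: "integrable ?N (\<lambda>z. r (2 * a - z))"
    unfolding r_refl by (intro Bochner_Integration.integrable_diff Bochner_Integration.integrable_add integrable_tail_1 integrable_mult_right ind) auto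
  have e1: "(\<integral>z. r z \<partial>?N) = tail_moment 1 (a - t) - tail_moment 1 (a - u) - (t - u) * p1"
    unfolding r_def tail_moment_def p1_def by (simp add: integrable_tail_1 ind del: Bochner_Integration.integral_indicator)
  have e2: "(\<integral>z. r (2 * a - z) \<partial>?N) = tail_moment 1 (a + t) - tail_moment 1 (a + u) + (t - u) * p2"
    unfolding r_refl tail_moment_def p2_def by (simp add: integrable_tail_1 ind del: Bochner_Integration.integral_indicator)
  have i1: "integrable lborel (\<lambda>z. std_normal_density z * r z)"
    using r_int by (subst (asm) integrable_density) auto
  have "integrable lborel (\<lambda>z. std_normal_density z * r (2 * a - z))"
    using r'_int by (subst (asm) integrable_density) auto
  then have i2: "integrable lborel (\<lambda>z. std_normal_density (2 * a - z) * r z)"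
    using lborel_integrable_real_affine_iff[of "-1" "\<lambda>z. std_normal_density (2 * a - z) * r z" "2 * a"] by simp
  have "(\<integral>z. r (2 * a - z) \<partial>?N) = (\<integral>z. std_normal_density z * r (2 * a - z) \<partial>lborel)"
    by (rule integral_std_normal_density) simp
  also have "\<dots> = (\<integral>z. std_normal_density (2 * a - z) * r z \<partial>lborel)"
    by (subst (2) lborel_integral_real_affine[where c = "-1" and t = "2 * a"]) simp_all
  also have "\<dots> \<le> (\<integral>z. std_normal_density z * r z \<partial>lborel)"
  proof (rule integral_mono[OF i2 i1])
    fix z
    show "std_normal_density (2 * a - z) * r z \<le> std_normal_density z * r z"
    proof (cases "z \<le> a")
      case True
      \<comment> \<open>Since \<open>a\<close> is nonnegative, reflecting a point left of
        \<open>a\<close> about \<open>a\<close> moves it no closer to the origin.\<close>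
      then have "z\<^sup>2 \<le> (2 * a - z)\<^sup>2"
        using a by (simp add: abs_le_square_iff[symmetric])
      then have "std_normal_density (2 * a - z) \<le> std_normal_density z"
        by (simp add: std_normal_density_def divide_right_mono)
      then show ?thesis using r_nonneg by (intro mult_right_mono) auto
    qed (simp add: r_zero)
  qed
  also have "\<dots> = (\<integral>z. r z \<partial>?N)"
    by (rule integral_std_normal_density[symmetric]) simp
  finally show "soft_mean a u + (p1 + p2) * (t - u) \<le> soft_mean a t"
    unfolding e1 e2 soft_mean_eq[OF a] by (simp add: algebra_simps)
qed

lemma soft_mean_uminus: "0 \<le> a \<Longrightarrow> soft_mean a (- t) = - soft_mean a t"
  by (simp add: soft_mean_eq)

text \<open>Convexity of \<open>t \<mapsto> t * soft_mean a t\<close> in the variable \<open>t\<^sup>2\<close>.\<close>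

lemma soft_mean_sq_tangent:
  assumes a: "0 \<le> a" and u: "0 < u"
  obtains s where "s \<le> 2" "u * soft_mean a u \<le> s * u\<^sup>2"
    "\<And>t. u * soft_mean a u + s * (t\<^sup>2 - u\<^sup>2) \<le> t * soft_mean a t"
proof -
  obtain p where p: "p \<le> 2" "\<And>t. 0 \<le> t \<Longrightarrow> soft_mean a u + p * (t - u) \<le> soft_mean a t"
    using soft_mean_tangent[OF a, of u] u by (metis less_imp_le)
  define q where "q = soft_mean a u / u"
  have q: "soft_mean a u = q * u" using u by (simp add: q_def)
  \<comment> \<open>The tangent at \<open>u\<close> is evaluated at zero, where the odd function
    \<open>soft_mean a\<close> vanishes; the slope thus exceeds the secant slope
    \<open>q\<close>.\<close>
  have "soft_mean a u \<le> p * u" using p(2)[of 0] a by (simp add: soft_mean_eq)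
  then have qp: "q \<le> p" using u by (simp add: q)
  \<comment> \<open>If \<open>p\<close> is the derivative of \<open>soft_mean a\<close> at
    \<open>u\<close>, this is the derivative of \<open>t * soft_mean a t\<close> with respect to
    \<open>t\<^sup>2\<close> at \<open>u\<close>.\<close>
  define s where "s = (q + p) / 2"
  have pos: "u * soft_mean a u + s * (t\<^sup>2 - u\<^sup>2) \<le> t * soft_mean a t" if "0 \<le> t" for t
  proof -
    have "t * (q * u + p * (t - u)) \<le> t * soft_mean a t"
      using p(2)[OF that] that by (intro mult_left_mono) (auto simp: q)
    moreover have "t * (q * u + p * (t - u)) - (u * (q * u) + s * (t\<^sup>2 - u\<^sup>2)) = (p - q) / 2 * (t - u)\<^sup>2"
      by (simp add: s_def power2_eq_square field_simps)
    moreover have "0 \<le> (p - q) / 2 * (t - u)\<^sup>2" using qp by simp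
    ultimately show ?thesis by (simp add: q)
  qed
  show ?thesis
  proof (rule that)
    show "s \<le> 2" using qp p(1) by (simp add: s_def)
    have "q * u\<^sup>2 \<le> s * u\<^sup>2" using qp by (intro mult_right_mono) (auto simp: s_def)
    then show "u * soft_mean a u \<le> s * u\<^sup>2" by (simp add: q power2_eq_square algebra_simps)
    show "u * soft_mean a u + s * (t\<^sup>2 - u\<^sup>2) \<le> t * soft_mean a t" for t
      using pos[of t] pos[of "- t"] soft_mean_uminus[OF a, of t] by (cases "0 \<le> t") auto
  qed
qed

section \<open>Two-sided bounds for Gaussian tail moments\<close>

lemma has_bochner_integral_power_exp:
  fixes a :: real
  assumes a: "0 < a"
  shows "has_bochner_integral lborel (\<lambda>x. indicator {0..} x * (x ^ k * exp (- (a * x)))) (fact k / a ^ (k + 1))"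
proof (rule has_bochner_integral_nn_integral)
  let ?f = "\<lambda>x. ennreal (indicator {0..} x * (x ^ k * exp (- (a * x))))"
  have "(\<integral>\<^sup>+x. ?f x \<partial>lborel) = ennreal (1 / a) * (\<integral>\<^sup>+x. ?f (x / a) \<partial>lborel)"
    using a by (subst nn_integral_real_affine[where c = "1 / a" and t = 0]) auto
  also have "(\<integral>\<^sup>+x. ?f (x / a) \<partial>lborel)
      = (\<integral>\<^sup>+x. ennreal (1 / a ^ k) * (ennreal (x ^ k * exp (- x)) * indicator {0..} x) \<partial>lborel)"
    using a by (intro nn_integral_cong)
      (auto simp: indicator_def power_divide ennreal_mult[symmetric] field_simps)
  also have "\<dots> = ennreal (1 / a ^ k) * ennreal (fact k)"
    by (subst nn_integral_cmult) (simp_all add: nn_intergal_power_times_exp_Ici)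
  also have "ennreal (1 / a) * \<dots> = ennreal (fact k / a ^ (k + 1))"
    using a by (simp add: ennreal_mult[symmetric])
  finally show "(\<integral>\<^sup>+x. ?f x \<partial>lborel) = ennreal (fact k / a ^ (k + 1))" .
qed (use a in \<open>auto simp: indicator_def\<close>)

text \<open>Shifted by \<open>a\<close>, the density is
  \<open>std_normal_density a * exp (- a * x) * exp (- x\<^sup>2 / 2)\<close>. Bounding the last
  factor between \<open>1 - x\<^sup>2 / 2\<close> and 1 leaves Gamma integrals. Positivity of
  \<open>k\<close> makes the power of the hinge vanish on the negative axis, where a zeroth power
  would be 1.\<close>

lemma tail_moment_bounds:
  assumes a: "0 < a" and k: "0 < k"
  shows "std_normal_density a * (fact k / a ^ (k + 1) - fact (k + 2) / (2 * a ^ (k + 3))) \<le> tail_moment k a"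
    and "tail_moment k a \<le> std_normal_density a * (fact k / a ^ (k + 1))"
proof -
  let ?E = "\<lambda>k x. indicator {0..} x * (x ^ k * exp (- (a * x))) :: real"
  let ?g = "\<lambda>x. std_normal_density (a + x) * (max 0 x) ^ k"
  note E = has_bochner_integral_power_exp[OF a]
  have int: "integrable lborel (?E j)" "(\<integral>x. ?E j x \<partial>lborel) = fact j / a ^ (j + 1)" for j
    using E[of j] by (auto simp: has_bochner_integral_iff)
  have eq: "tail_moment k a = (\<integral>x. ?g x \<partial>lborel)"
    unfolding tail_moment_def
    by (subst integral_std_normal_density, simp, subst lborel_integral_real_affine[where c = 1 and t = a]) simp_all
  have shift: "std_normal_density (a + x) = std_normal_density a * (exp (- (a * x)) * exp (- x\<^sup>2 / 2))" for x
    by (simp add: std_normal_density_def exp_add[symmetric] power2_eq_square field_simps)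
  have g: "?g x = std_normal_density a * (?E k x * exp (- x\<^sup>2 / 2))" for x
    unfolding shift using k by (auto simp: indicator_def max_def)
  have up: "?g x \<le> std_normal_density a * ?E k x" for x
    unfolding g by (intro mult_left_mono mult_left_le) (auto simp: indicator_def)
  have g_nonneg: "0 \<le> ?g x" for x by simp
  have gi: "integrable lborel ?g"
    using up g_nonneg
    by (intro Bochner_Integration.integrable_bound[OF integrable_mult_right[OF int(1)[of k], of "std_normal_density a"]]) (auto intro: order_trans[OF _ abs_ge_self])
  have low: "std_normal_density a * (?E k x - ?E (k + 2) x / 2) \<le> ?g x" for x
  proof -
    have "1 - x\<^sup>2 / 2 \<le> exp (- x\<^sup>2 / 2)" using exp_ge_add_one_self[of "- x\<^sup>2 / 2"] by simp
    then have "?E k x * (1 - x\<^sup>2 / 2) \<le> ?E k x * exp (- x\<^sup>2 / 2)"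
      by (intro mult_left_mono) (auto simp: indicator_def)
    moreover have "?E k x * (1 - x\<^sup>2 / 2) = ?E k x - ?E (k + 2) x / 2"
      by (simp add: power_add power2_eq_square algebra_simps)
    ultimately show ?thesis unfolding g by (intro mult_left_mono) auto
  qed
  have "(\<integral>x. std_normal_density a * (?E k x - ?E (k + 2) x / 2) \<partial>lborel)
      = std_normal_density a * (fact k / a ^ (k + 1) - fact (k + 2) / a ^ (k + 2 + 1) / 2)"
    by (simp only: integral_mult_right_zero Bochner_Integration.integral_diff int integrable_divide integral_divide_zero)
  moreover have "(\<integral>x. std_normal_density a * (?E k x - ?E (k + 2) x / 2) \<partial>lborel) \<le> tail_moment k a"
    unfolding eq by (intro integral_mono low gi integrable_mult_right Bochner_Integration.integrable_diff integrable_divide int)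
  ultimately show "std_normal_density a * (fact k / a ^ (k + 1) - fact (k + 2) / (2 * a ^ (k + 3))) \<le> tail_moment k a"
    by (simp add: eval_nat_numeral algebra_simps)
  have "tail_moment k a \<le> (\<integral>x. std_normal_density a * ?E k x \<partial>lborel)"
    unfolding eq by (intro integral_mono up gi integrable_mult_right int)
  then show "tail_moment k a \<le> std_normal_density a * (fact k / a ^ (k + 1))"
    by (simp add: int)
qed

text \<open>The expanded mean squared error of \<open>c * soft a (t + Z)\<close> for standard normal
  Z. The cross term drives the gain at the spikes, the last term the loss at the zeros.\<close>

definition soft_risk :: "real \<Rightarrow> real \<Rightarrow> real \<Rightarrow> real" where
  "soft_risk c a t = t\<^sup>2 - 2 * c * (t * soft_mean a t) + c\<^sup>2 * soft_square a t"

lemma nn_integral_soft_risk: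
  assumes "0 \<le> a"
  shows "(\<integral>\<^sup>+x. ennreal ((c * soft a (t + x) - t)\<^sup>2) \<partial>std_normal_distribution) = ennreal (soft_risk c a t)"
    and "0 \<le> soft_risk c a t"
proof -
  interpret prob_space std_normal_distribution by (rule prob_space_std_normal)
  have *: "(c * soft a (t + x) - t)\<^sup>2 = t\<^sup>2 - 2 * c * t * soft a (t + x) + c\<^sup>2 * (soft a (t + x))\<^sup>2" for x
    by (simp add: power2_diff power_mult_distrib)
  note i = integrable_soft[OF assms, of t]
  have int: "integrable std_normal_distribution (\<lambda>x. (c * soft a (t + x) - t)\<^sup>2)"
    unfolding * using i by simp
  have eq: "(\<integral>x. (c * soft a (t + x) - t)\<^sup>2 \<partial>std_normal_distribution) = soft_risk c a t"
    unfolding * using i prob_space by (simp add: soft_risk_def soft_mean_def soft_square_def)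
  show "(\<integral>\<^sup>+x. ennreal ((c * soft a (t + x) - t)\<^sup>2) \<partial>std_normal_distribution) = ennreal (soft_risk c a t)"
    using nn_integral_eq_integral[OF int] eq by simp
  show "0 \<le> soft_risk c a t" unfolding eq[symmetric] by simp
qed

subsection \<open>Worst-case risk of soft thresholding\<close>

lemma soft_scale: "0 < \<sigma> \<Longrightarrow> soft (\<sigma> * a) (\<sigma> * x) = \<sigma> * soft a x"
  by (auto simp: soft_def abs_mult sgn_mult max_def algebra_simps)

lemma eta_E_in_estimators: "eta_E n lam \<gamma> \<in> estimators n"
  unfolding estimators_def eta_E_def by measurable

text \<open>The threshold scales with \<sigma>, so the problem reduces to unit noise, and the loss
  is additive over coordinates.\<close>

lemma sq_risk_eta_E:
  assumes \<sigma>: "0 < \<sigma>" and a: "0 \<le> a"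
  shows "sq_risk n \<sigma> (eta_E n (\<sigma> * a) \<gamma>) \<theta>
       = ennreal (\<sigma>\<^sup>2 * (\<Sum>i\<in>{1..n}. soft_risk (1 / (1 + \<gamma>)) a (\<theta> i / \<sigma>)))"
proof -
  let ?c = "1 / (1 + \<gamma>)"
  have [measurable]: "(\<lambda>y. eta_E n (\<sigma> * a) \<gamma> y i) \<in> borel_measurable (Rn n)" if "i \<in> {1..n}" for i
    using estimator_component[OF eta_E_in_estimators that] .
  have [measurable]: "(\<lambda>z. z i) \<in> borel_measurable (noise n)" if "i \<in> {1..n}" for i
    unfolding measurable_noise_cong using that by auto
  have "sq_risk n \<sigma> (eta_E n (\<sigma> * a) \<gamma>) \<theta>
      = (\<integral>\<^sup>+z. ennreal (l2_norm_sq n (\<lambda>i. eta_E n (\<sigma> * a) \<gamma> (\<lambda>i\<in>{1..n}. \<theta> i + \<sigma> * z i) i - \<theta> i)) \<partial>noise n)"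
    unfolding sq_risk_def l2_norm_sq_def by (rule nn_integral_obs_law) measurable
  also have "\<dots> = (\<integral>\<^sup>+z. (\<Sum>i\<in>{1..n}. ennreal (\<sigma>\<^sup>2) * ennreal ((?c * soft a (\<theta> i / \<sigma> + z i) - \<theta> i / \<sigma>)\<^sup>2)) \<partial>noise n)"
  proof (intro nn_integral_cong)
    fix z :: "nat \<Rightarrow> real"
    have "(eta_E n (\<sigma> * a) \<gamma> (\<lambda>i\<in>{1..n}. \<theta> i + \<sigma> * z i) i - \<theta> i)\<^sup>2
        = \<sigma>\<^sup>2 * (?c * soft a (\<theta> i / \<sigma> + z i) - \<theta> i / \<sigma>)\<^sup>2" if i: "i \<in> {1..n}" for i
    proof -
      have y: "\<theta> i + \<sigma> * z i = \<sigma> * (\<theta> i / \<sigma> + z i)" using \<sigma> by (simp add: field_simps)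
      have "eta_E n (\<sigma> * a) \<gamma> (\<lambda>i\<in>{1..n}. \<theta> i + \<sigma> * z i) i = ?c * soft (\<sigma> * a) (\<theta> i + \<sigma> * z i)"
        using i by (simp add: eta_E_def soft_def)
      also have "\<dots> = \<sigma> * (?c * soft a (\<theta> i / \<sigma> + z i))"
        unfolding y soft_scale[OF \<sigma>] by simp
      finally have "eta_E n (\<sigma> * a) \<gamma> (\<lambda>i\<in>{1..n}. \<theta> i + \<sigma> * z i) i - \<theta> i
          = \<sigma> * (?c * soft a (\<theta> i / \<sigma> + z i) - \<theta> i / \<sigma>)"
        using \<sigma> by (simp add: right_diff_distrib)
      then show ?thesis by (simp only: power_mult_distrib)
    qed
    then have "l2_norm_sq n (\<lambda>i. eta_E n (\<sigma> * a) \<gamma> (\<lambda>i\<in>{1..n}. \<theta> i + \<sigma> * z i) i - \<theta> i)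
        = (\<Sum>i\<in>{1..n}. \<sigma>\<^sup>2 * (?c * soft a (\<theta> i / \<sigma> + z i) - \<theta> i / \<sigma>)\<^sup>2)"
      unfolding l2_norm_sq_def by (intro sum.cong refl)
    then show "ennreal (l2_norm_sq n (\<lambda>i. eta_E n (\<sigma> * a) \<gamma> (\<lambda>i\<in>{1..n}. \<theta> i + \<sigma> * z i) i - \<theta> i))
        = (\<Sum>i\<in>{1..n}. ennreal (\<sigma>\<^sup>2) * ennreal ((?c * soft a (\<theta> i / \<sigma> + z i) - \<theta> i / \<sigma>)\<^sup>2))"
      by (simp add: ennreal_mult[symmetric])
  qed
  also have "\<dots> = (\<Sum>i\<in>{1..n}. ennreal (\<sigma>\<^sup>2) * (\<integral>\<^sup>+z. ennreal ((?c * soft a (\<theta> i / \<sigma> + z i) - \<theta> i / \<sigma>)\<^sup>2) \<partial>noise n))"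
    by (subst nn_integral_sum) (auto intro!: sum.cong nn_integral_cmult)
  also have "\<dots> = (\<Sum>i\<in>{1..n}. ennreal (\<sigma>\<^sup>2) * ennreal (soft_risk ?c a (\<theta> i / \<sigma>)))"
  proof (intro sum.cong refl arg_cong2[where f = times])
    fix i assume "i \<in> {1..n}"
    then show "(\<integral>\<^sup>+z. ennreal ((?c * soft a (\<theta> i / \<sigma> + z i) - \<theta> i / \<sigma>)\<^sup>2) \<partial>noise n) = ennreal (soft_risk ?c a (\<theta> i / \<sigma>))"
      using nn_integral_PiM_component[OF prob_space_std_normal, of "{1..n}" i
          "\<lambda>x. ennreal ((?c * soft a (\<theta> i / \<sigma> + x) - \<theta> i / \<sigma>)\<^sup>2)"]
      unfolding noise_def nn_integral_soft_risk(1)[OF a] by simp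
  qed
  also have "\<dots> = ennreal (\<sigma>\<^sup>2 * (\<Sum>i\<in>{1..n}. soft_risk ?c a (\<theta> i / \<sigma>)))"
    using nn_integral_soft_risk(2)[OF a]
    by (simp add: ennreal_mult[symmetric] sum_distrib_left)
  finally show ?thesis .
qed

lemma sparse_ball_scaled:
  assumes \<sigma>: "0 < \<sigma>" and \<theta>: "\<theta> \<in> sparse_ball n k (\<sigma> * \<mu>)"
  shows "(\<Sum>i\<in>{1..n}. (\<theta> i / \<sigma>)\<^sup>2) \<le> real k * \<mu>\<^sup>2" "card {i \<in> {1..n}. \<theta> i \<noteq> 0} \<le> k"
proof -
  have "(\<Sum>i\<in>{1..n}. (\<theta> i)\<^sup>2) \<le> (real k * \<mu>\<^sup>2) * \<sigma>\<^sup>2"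
    using \<theta> by (simp add: sparse_ball_def l2_norm_sq_def power_mult_distrib algebra_simps)
  then show "(\<Sum>i\<in>{1..n}. (\<theta> i / \<sigma>)\<^sup>2) \<le> real k * \<mu>\<^sup>2"
    using \<sigma> by (simp add: power_divide sum_divide_distrib[symmetric] field_simps)
  show "card {i \<in> {1..n}. \<theta> i \<noteq> 0} \<le> k"
    using \<theta> by (simp add: sparse_ball_def l0_norm_def)
qed

text \<open>Adding the nonnegative risk for \<open>- c\<close> cancels the cross term, so no bound
  on \<open>soft_mean\<close> and no sign of \<open>c\<close> enters.\<close>

lemma soft_risk_crude:
  assumes "0 \<le> a"
  shows "soft_risk c a t \<le> 2 * t\<^sup>2 + 2 * c\<^sup>2 * (2 * t\<^sup>2 + 2)"
proof -
  have "soft_risk c a t \<le> soft_risk c a t + soft_risk (- c) a t"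
    using nn_integral_soft_risk(2)[OF assms] by simp
  also have "\<dots> = 2 * t\<^sup>2 + 2 * c\<^sup>2 * soft_square a t"
    by (simp add: soft_risk_def)
  also have "\<dots> \<le> 2 * t\<^sup>2 + 2 * c\<^sup>2 * (2 * t\<^sup>2 + 2)"
    using soft_square_le[OF assms] by (intro add_left_mono mult_left_mono) auto
  finally show ?thesis .
qed

lemma soft_risk_0: "soft_risk c a 0 = c\<^sup>2 * soft_square a 0"
  by (simp add: soft_risk_def)

text \<open>Finiteness must hold for every shrinkage factor, because the equality in the theorem is
  claimed for all n and is read off through \<open>enn2real\<close>.\<close>

lemma sup_risk_eta_E_finite:
  assumes \<sigma>: "0 < \<sigma>" and a: "0 \<le> a"
  shows "sup_risk n \<sigma> (sparse_ball n k (\<sigma> * \<mu>)) (eta_E n (\<sigma> * a) \<gamma>) < \<top>"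
proof -
  let ?c = "1 / (1 + \<gamma>)"
  let ?B = "\<sigma>\<^sup>2 * ((2 + 4 * ?c\<^sup>2) * (real k * \<mu>\<^sup>2) + real n * (4 * ?c\<^sup>2))"
  have "sq_risk n \<sigma> (eta_E n (\<sigma> * a) \<gamma>) \<theta> \<le> ennreal ?B" if \<theta>: "\<theta> \<in> sparse_ball n k (\<sigma> * \<mu>)" for \<theta>
    unfolding sq_risk_eta_E[OF \<sigma> a]
  proof (intro ennreal_leI mult_left_mono)
    have "(\<Sum>i\<in>{1..n}. soft_risk ?c a (\<theta> i / \<sigma>))
        \<le> (\<Sum>i\<in>{1..n}. (2 + 4 * ?c\<^sup>2) * (\<theta> i / \<sigma>)\<^sup>2 + 4 * ?c\<^sup>2)"
      using soft_risk_crude[OF a, of ?c] by (intro sum_mono) (simp add: algebra_simps)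
    also have "\<dots> = (2 + 4 * ?c\<^sup>2) * (\<Sum>i\<in>{1..n}. (\<theta> i / \<sigma>)\<^sup>2) + real n * (4 * ?c\<^sup>2)"
      by (simp only: sum.distrib sum_distrib_left[symmetric] sum_constant card_atLeastAtMost) simp
    also have "\<dots> \<le> (2 + 4 * ?c\<^sup>2) * (real k * \<mu>\<^sup>2) + real n * (4 * ?c\<^sup>2)"
      by (intro add_right_mono mult_left_mono sparse_ball_scaled(1)[OF \<sigma> \<theta>]) auto
    finally show "(\<Sum>i\<in>{1..n}. soft_risk ?c a (\<theta> i / \<sigma>)) \<le> (2 + 4 * ?c\<^sup>2) * (real k * \<mu>\<^sup>2) + real n * (4 * ?c\<^sup>2)" .
  qed simp
  then have "sup_risk n \<sigma> (sparse_ball n k (\<sigma> * \<mu>)) (eta_E n (\<sigma> * a) \<gamma>) \<le> ennreal ?B"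
    unfolding sup_risk_def by (rule SUP_least)
  then show ?thesis by (rule le_less_trans) simp
qed

text \<open>The tangent in \<open>t\<^sup>2\<close> at \<mu> bounds each risk by
  \<open>A * t\<^sup>2 + D\<close>. As both coefficients are nonnegative, the energy constraint
  controls the first part and the sparsity constraint the second.\<close>

lemma sup_risk_eta_E_upper:
  fixes \<sigma> \<mu> a \<gamma> :: real and n k :: nat
  assumes \<sigma>: "0 < \<sigma>" and a: "0 \<le> a" and \<mu>: "0 < \<mu>"
  defines "c \<equiv> 1 / (1 + \<gamma>)"
  assumes c: "0 \<le> c" "4 * c \<le> 1"
  shows "sup_risk n \<sigma> (sparse_ball n k (\<sigma> * \<mu>)) (eta_E n (\<sigma> * a) \<gamma>)
      \<le> ennreal (\<sigma>\<^sup>2 * (real n * (c\<^sup>2 * soft_square a 0) + real k * \<mu>\<^sup>2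
          - 2 * c * real k * \<mu> * soft_mean a \<mu> + 2 * c\<^sup>2 * real k * (1 + \<mu>\<^sup>2)))"
proof -
  obtain s where s: "s \<le> 2" "\<mu> * soft_mean a \<mu> \<le> s * \<mu>\<^sup>2"
    "\<And>t. \<mu> * soft_mean a \<mu> + s * (t\<^sup>2 - \<mu>\<^sup>2) \<le> t * soft_mean a t"
    by (rule soft_mean_sq_tangent[OF a \<mu>]) blast
  define d where "d = s * \<mu>\<^sup>2 - \<mu> * soft_mean a \<mu>"
  define A where "A = 1 - 2 * c * s + 2 * c\<^sup>2"
  define D where "D = 2 * c * d + 2 * c\<^sup>2"
  have d: "0 \<le> d" using s by (simp add: d_def)
  then have D: "0 \<le> D" using c by (simp add: D_def)
  have "c * s \<le> c * 2" using s c by (intro mult_left_mono) auto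
  \<comment> \<open>From \<open>s \<le> 2\<close> and \<open>4 * c \<le> 1\<close> one gets
    \<open>2 * c * s \<le> 1\<close>.\<close>
  then have A: "0 \<le> A" using c zero_le_power2[of c] unfolding A_def by linarith
  have risk: "soft_risk c a t \<le> A * t\<^sup>2 + D" for t
  proof -
    have "2 * c * (\<mu> * soft_mean a \<mu> + s * (t\<^sup>2 - \<mu>\<^sup>2)) \<le> 2 * c * (t * soft_mean a t)"
      using s(3) c by (intro mult_left_mono) auto
    moreover have "c\<^sup>2 * soft_square a t \<le> c\<^sup>2 * (2 * t\<^sup>2 + 2)"
      using soft_square_le[OF a] by (intro mult_left_mono) auto
    ultimately show ?thesis
      by (simp add: soft_risk_def A_def D_def d_def algebra_simps)
  qed
  have "sq_risk n \<sigma> (eta_E n (\<sigma> * a) \<gamma>) \<theta> \<le> ennreal (\<sigma>\<^sup>2 *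
      (real n * (c\<^sup>2 * soft_square a 0) + A * (real k * \<mu>\<^sup>2) + real k * D))"
    if \<theta>: "\<theta> \<in> sparse_ball n k (\<sigma> * \<mu>)" for \<theta>
    unfolding sq_risk_eta_E[OF \<sigma> a] c_def[symmetric]
  proof (intro ennreal_leI mult_left_mono)
    let ?S = "{i \<in> {1..n}. \<theta> i \<noteq> 0}"
    note ball = sparse_ball_scaled[OF \<sigma> \<theta>]
    have "(\<Sum>i\<in>{1..n}. soft_risk c a (\<theta> i / \<sigma>))
        \<le> (\<Sum>i\<in>{1..n}. c\<^sup>2 * soft_square a 0 + A * (\<theta> i / \<sigma>)\<^sup>2 + (if \<theta> i \<noteq> 0 then D else 0))"
    \<comment> \<open>The risk at zero is charged to all \<open>n\<close> coordinates, also those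
      with a spike; this only increases the bound.\<close>
    proof (intro sum_mono)
      fix i
      have "0 \<le> c\<^sup>2 * soft_square a 0" by (simp add: soft_square_nonneg)
      then show "soft_risk c a (\<theta> i / \<sigma>) \<le> c\<^sup>2 * soft_square a 0 + A * (\<theta> i / \<sigma>)\<^sup>2 + (if \<theta> i \<noteq> 0 then D else 0)"
        using risk[of "\<theta> i / \<sigma>"] by (cases "\<theta> i = 0") (simp_all add: soft_risk_0)
    qed
    also have "\<dots> = real n * (c\<^sup>2 * soft_square a 0) + A * (\<Sum>i\<in>{1..n}. (\<theta> i / \<sigma>)\<^sup>2) + real (card ?S) * D"
    proof -
      have "(\<Sum>i\<in>{1..n}. if \<theta> i \<noteq> 0 then D else 0) = real (card ?S) * D"
        by (subst sum.inter_filter[symmetric]) simp_all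
      then show ?thesis
        by (simp only: sum.distrib sum_distrib_left[symmetric] sum_constant card_atLeastAtMost) simp
    qed
    also have "\<dots> \<le> real n * (c\<^sup>2 * soft_square a 0) + A * (real k * \<mu>\<^sup>2) + real k * D"
      using ball A D by (intro add_mono mult_left_mono mult_right_mono) auto
    finally show "(\<Sum>i\<in>{1..n}. soft_risk c a (\<theta> i / \<sigma>))
        \<le> real n * (c\<^sup>2 * soft_square a 0) + A * (real k * \<mu>\<^sup>2) + real k * D" .
  qed simp
  then have "sup_risk n \<sigma> (sparse_ball n k (\<sigma> * \<mu>)) (eta_E n (\<sigma> * a) \<gamma>) \<le> ennreal (\<sigma>\<^sup>2 *
      (real n * (c\<^sup>2 * soft_square a 0) + A * (real k * \<mu>\<^sup>2) + real k * D))"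
    unfolding sup_risk_def by (rule SUP_least)
  \<comment> \<open>The slope \<open>s\<close> drops out because the line is evaluated at its
    contact point \<mu>.\<close>
  also have "real n * (c\<^sup>2 * soft_square a 0) + A * (real k * \<mu>\<^sup>2) + real k * D
      = real n * (c\<^sup>2 * soft_square a 0) + real k * \<mu>\<^sup>2
          - 2 * c * real k * \<mu> * soft_mean a \<mu> + 2 * c\<^sup>2 * real k * (1 + \<mu>\<^sup>2)"
    by (simp add: A_def D_def d_def algebra_simps)
  finally show ?thesis .
qed

text \<open>The witness has its first \<open>k\<close> entries equal to
  \<open>\<sigma> * \<mu>\<close>. Discarding the nonnegative second-moment term at the spikes
  leaves an expression differing from the upper bound only in lower-order terms.\<close>

lemma sup_risk_eta_E_lower:
  fixes \<sigma> \<mu> a \<gamma> :: real and n k :: nat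
  assumes \<sigma>: "0 < \<sigma>" and a: "0 \<le> a" and \<mu>: "0 < \<mu>" and kn: "k \<le> n"
  defines "c \<equiv> 1 / (1 + \<gamma>)"
  shows "ennreal (\<sigma>\<^sup>2 * ((real n - real k) * (c\<^sup>2 * soft_square a 0) + real k * \<mu>\<^sup>2
          - 2 * c * real k * \<mu> * soft_mean a \<mu>))
      \<le> sup_risk n \<sigma> (sparse_ball n k (\<sigma> * \<mu>)) (eta_E n (\<sigma> * a) \<gamma>)"
proof -
  define \<theta> where "\<theta> = (\<lambda>i\<in>{1..n}. if i \<le> k then \<sigma> * \<mu> else 0)"
  have split: "{1..n} = {1..k} \<union> {k+1..n}" "{1..k} \<inter> {k+1..n} = {}" using kn by auto
  have "{i \<in> {1..n}. \<theta> i \<noteq> 0} \<subseteq> {1..k}" by (auto simp: \<theta>_def split: if_splits)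
  then have "l0_norm n \<theta> \<le> k"
    unfolding l0_norm_def using card_mono[of "{1..k}"] by fastforce
  moreover have "l2_norm_sq n \<theta> = real k * (\<sigma> * \<mu>)\<^sup>2"
  proof -
    have "l2_norm_sq n \<theta> = (\<Sum>i\<in>{1..k}. (\<theta> i)\<^sup>2) + (\<Sum>i\<in>{k+1..n}. (\<theta> i)\<^sup>2)"
      unfolding l2_norm_sq_def split(1) using split(2) by (intro sum.union_disjoint) auto
    also have "(\<Sum>i\<in>{1..k}. (\<theta> i)\<^sup>2) = (\<Sum>i\<in>{1..k}. (\<sigma> * \<mu>)\<^sup>2)"
      using kn by (intro sum.cong) (auto simp: \<theta>_def)
    also have "(\<Sum>i\<in>{k+1..n}. (\<theta> i)\<^sup>2) = 0"
      by (intro sum.neutral) (auto simp: \<theta>_def)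
    finally show ?thesis by simp
  qed
  ultimately have ball: "\<theta> \<in> sparse_ball n k (\<sigma> * \<mu>)"
    by (simp add: sparse_ball_def \<theta>_def)
  have "(\<Sum>i\<in>{1..n}. soft_risk c a (\<theta> i / \<sigma>))
      = (\<Sum>i\<in>{1..k}. soft_risk c a (\<theta> i / \<sigma>)) + (\<Sum>i\<in>{k+1..n}. soft_risk c a (\<theta> i / \<sigma>))"
    unfolding split(1) using split(2) by (intro sum.union_disjoint) auto
  also have "(\<Sum>i\<in>{1..k}. soft_risk c a (\<theta> i / \<sigma>)) = (\<Sum>i\<in>{1..k}. soft_risk c a \<mu>)"
    using kn \<sigma> by (intro sum.cong) (auto simp: \<theta>_def)
  also have "(\<Sum>i\<in>{k+1..n}. soft_risk c a (\<theta> i / \<sigma>)) = (\<Sum>i\<in>{k+1..n}. c\<^sup>2 * soft_square a 0)"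
    by (intro sum.cong) (auto simp: \<theta>_def soft_risk_0)
  finally have eq: "(\<Sum>i\<in>{1..n}. soft_risk c a (\<theta> i / \<sigma>))
      = real k * soft_risk c a \<mu> + (real n - real k) * (c\<^sup>2 * soft_square a 0)"
    using kn by (simp add: of_nat_diff)
  have "real k * (\<mu>\<^sup>2 - 2 * c * (\<mu> * soft_mean a \<mu>)) \<le> real k * soft_risk c a \<mu>"
    by (intro mult_left_mono) (simp_all add: soft_risk_def soft_square_nonneg)
  then have "(real n - real k) * (c\<^sup>2 * soft_square a 0) + real k * \<mu>\<^sup>2
          - 2 * c * real k * \<mu> * soft_mean a \<mu> \<le> (\<Sum>i\<in>{1..n}. soft_risk c a (\<theta> i / \<sigma>))"
    unfolding eq by (simp add: algebra_simps)
  then have "ennreal (\<sigma>\<^sup>2 * ((real n - real k) * (c\<^sup>2 * soft_square a 0) + real k * \<mu>\<^sup>2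
          - 2 * c * real k * \<mu> * soft_mean a \<mu>)) \<le> sq_risk n \<sigma> (eta_E n (\<sigma> * a) \<gamma>) \<theta>"
    unfolding sq_risk_eta_E[OF \<sigma> a] c_def[symmetric] by (intro ennreal_leI mult_left_mono) auto
  also have "\<dots> \<le> sup_risk n \<sigma> (sparse_ball n k (\<sigma> * \<mu>)) (eta_E n (\<sigma> * a) \<gamma>)"
    unfolding sup_risk_def by (rule SUP_upper[OF ball])
  finally show ?thesis .
qed

subsection \<open>Asymptotics\<close>

text \<open>The prefactor is what remains of \<open>c\<^sup>2 * soft_square (2 * x) 0\<close> after
  division by the correction scale \<open>\<epsilon>\<^sup>2 * x * exp (x\<^sup>2)\<close>, with
  \<open>c\<close> the shrinkage factor at \<mu> = x.\<close>

lemma tail_moment_2_asymp: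
  "((\<lambda>x. 8 * x ^ 3 * exp (2 * x\<^sup>2) * tail_moment 2 (2 * x)) \<longlongrightarrow> sqrt (2 / pi)) at_top"
proof (rule tendsto_sandwich)
  define K where "K = sqrt (2 * pi)"
  have K: "0 < K" by (simp add: K_def)
  have r: "sqrt (2 / pi) = 2 * inverse K"
    by (simp add: K_def real_sqrt_divide real_sqrt_mult field_simps)
  have d: "std_normal_density (2 * x) = exp (- (2 * x\<^sup>2)) / K" for x
    by (simp add: std_normal_density_def power_mult_distrib K_def)
  let ?l = "\<lambda>x::real. 8 * x ^ 3 * exp (2 * x\<^sup>2) * (exp (- (2 * x\<^sup>2)) / K * (2 / (2 * x) ^ 3 - 24 / (2 * (2 * x) ^ 5)))"
  let ?u = "\<lambda>x::real. 8 * x ^ 3 * exp (2 * x\<^sup>2) * (exp (- (2 * x\<^sup>2)) / K * (2 / (2 * x) ^ 3))"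
  have lower: "?l x \<le> 8 * x ^ 3 * exp (2 * x\<^sup>2) * tail_moment 2 (2 * x)"
    and upper: "8 * x ^ 3 * exp (2 * x\<^sup>2) * tail_moment 2 (2 * x) \<le> ?u x" if "0 < x" for x
    using tail_moment_bounds[of "2 * x" 2] that
    by (intro mult_left_mono; simp add: d fact_numeral)+
  show "eventually (\<lambda>x. ?l x \<le> 8 * x ^ 3 * exp (2 * x\<^sup>2) * tail_moment 2 (2 * x)) at_top"
    by (rule eventually_mono[OF eventually_gt_at_top lower])
  show "eventually (\<lambda>x. 8 * x ^ 3 * exp (2 * x\<^sup>2) * tail_moment 2 (2 * x) \<le> ?u x) at_top"
    by (rule eventually_mono[OF eventually_gt_at_top upper])
  show "(?l \<longlongrightarrow> sqrt (2 / pi)) at_top" "(?u \<longlongrightarrow> sqrt (2 / pi)) at_top"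
    unfolding r using K by real_asymp+
qed

text \<open>This is the cross term \<open>2 * c * \<epsilon> * x * soft_mean (2 * x) x\<close> on
  the same scale. The tail beyond \<open>3 * x\<close> is exponentially smaller than the one beyond
  \<open>x\<close>; the limit is twice that of the zero coordinates.\<close>

lemma soft_mean_asymp:
  "((\<lambda>x. 4 * x\<^sup>2 * exp (x\<^sup>2 / 2) * soft_mean (2 * x) x) \<longlongrightarrow> 2 * sqrt (2 / pi)) at_top"
proof (rule tendsto_sandwich)
  define K where "K = sqrt (2 * pi)"
  have K: "0 < K" by (simp add: K_def)
  have r: "sqrt (2 / pi) = 2 * inverse K"
    by (simp add: K_def real_sqrt_divide real_sqrt_mult field_simps)
  let ?d = "\<lambda>x. exp (- (x\<^sup>2 / 2)) / K"
  have d: "std_normal_density x = ?d x" for x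
    by (simp add: std_normal_density_def K_def)
  let ?l = "\<lambda>x::real. 4 * x\<^sup>2 * exp (x\<^sup>2 / 2) * (?d x * (1 / x\<^sup>2 - 6 / (2 * x ^ 4)) - ?d (3 * x) * (1 / (3 * x)\<^sup>2))"
  let ?u = "\<lambda>x::real. 4 * x\<^sup>2 * exp (x\<^sup>2 / 2) * (?d x * (1 / x\<^sup>2))"
  have lower: "?l x \<le> 4 * x\<^sup>2 * exp (x\<^sup>2 / 2) * soft_mean (2 * x) x"
    and upper: "4 * x\<^sup>2 * exp (x\<^sup>2 / 2) * soft_mean (2 * x) x \<le> ?u x" if x: "0 < x" for x
  proof -
    have "0 \<le> tail_moment 1 (3 * x)" unfolding tail_moment_def by simp
    moreover have "?d x * (1 / x\<^sup>2 - 6 / (2 * x ^ 4)) \<le> tail_moment 1 x" "tail_moment 1 x \<le> ?d x * (1 / x\<^sup>2)"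
      using tail_moment_bounds[of x 1] x by (simp_all add: d fact_numeral numeral_eq_Suc)
    moreover have "tail_moment 1 (3 * x) \<le> ?d (3 * x) * (1 / (3 * x)\<^sup>2)"
      using tail_moment_bounds(2)[of "3 * x" 1] x by (simp add: d numeral_eq_Suc)
    moreover have "soft_mean (2 * x) x = tail_moment 1 x - tail_moment 1 (3 * x)"
      using x by (simp add: soft_mean_eq)
    ultimately show "?l x \<le> 4 * x\<^sup>2 * exp (x\<^sup>2 / 2) * soft_mean (2 * x) x"
      "4 * x\<^sup>2 * exp (x\<^sup>2 / 2) * soft_mean (2 * x) x \<le> ?u x"
      by (intro mult_left_mono; simp)+
  qed
  show "eventually (\<lambda>x. ?l x \<le> 4 * x\<^sup>2 * exp (x\<^sup>2 / 2) * soft_mean (2 * x) x) at_top"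
    by (rule eventually_mono[OF eventually_gt_at_top lower])
  show "eventually (\<lambda>x. 4 * x\<^sup>2 * exp (x\<^sup>2 / 2) * soft_mean (2 * x) x \<le> ?u x) at_top"
    by (rule eventually_mono[OF eventually_gt_at_top upper])
  show "(?l \<longlongrightarrow> 2 * sqrt (2 / pi)) at_top" "(?u \<longlongrightarrow> 2 * sqrt (2 / pi)) at_top"
    unfolding r using K by real_asymp+
qed

text \<open>Eventually \<open>(C + 1) \<mu>\<^sup>2 \<le> ln (1/\<epsilon>) / 2\<close>, and then the product is at most
  \<open>sqrt \<epsilon>\<close> times \<open>\<mu> ^ p * exp (- \<mu>\<^sup>2)\<close>.\<close>

lemma sparsity_beats_exp:
  fixes \<epsilon> \<mu> :: "nat \<Rightarrow> real"
  assumes eps: "\<epsilon> \<longlonglongrightarrow> 0" "eventually (\<lambda>n. 0 < \<epsilon> n) sequentially"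
    and mu: "filterlim \<mu> at_top sequentially"
    and small: "(\<lambda>n. \<mu> n / sqrt (ln (1 / \<epsilon> n))) \<longlonglongrightarrow> 0"
    and C: "0 \<le> C"
  shows "(\<lambda>n. \<epsilon> n * (\<mu> n) ^ p * exp (C * (\<mu> n)\<^sup>2)) \<longlonglongrightarrow> 0"
proof (rule tendsto_sandwich[OF _ _ tendsto_const])
  \<comment> \<open>Chosen so that \<open>\<mu> n \<le> r * sqrt l\<close> becomes
    \<open>(C + 1) * (\<mu> n)\<^sup>2 \<le> l / 2\<close>.\<close>
  define r where "r = 1 / sqrt (2 * (C + 1))"
  have r: "0 < r" "r\<^sup>2 = 1 / (2 * (C + 1))" using C by (simp_all add: r_def power_divide)
  have ev: "eventually (\<lambda>n. 0 < \<epsilon> n \<and> \<epsilon> n < 1 \<and> 0 < \<mu> n \<and> \<mu> n / sqrt (ln (1 / \<epsilon> n)) < r) sequentially"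
    using order_tendstoD(2)[OF eps(1) zero_less_one] eps(2) filterlim_at_top_dense[THEN iffD1, OF mu, rule_format, of 0]
      order_tendstoD(2)[OF small r(1)] by eventually_elim auto
  then show "eventually (\<lambda>n. 0 \<le> \<epsilon> n * (\<mu> n) ^ p * exp (C * (\<mu> n)\<^sup>2)) sequentially"
    by eventually_elim auto
  from ev show "eventually (\<lambda>n. \<epsilon> n * (\<mu> n) ^ p * exp (C * (\<mu> n)\<^sup>2)
      \<le> sqrt (\<epsilon> n) * ((\<mu> n) ^ p * exp (- (\<mu> n)\<^sup>2))) sequentially"
  proof eventually_elim
    case (elim n)
    define l where "l = ln (1 / \<epsilon> n)"
    have l: "0 < l" using elim by (simp add: l_def)
    have "\<mu> n \<le> r * sqrt l" using elim l by (simp add: l_def[symmetric] field_simps)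
    then have "(\<mu> n)\<^sup>2 \<le> (r * sqrt l)\<^sup>2" using elim by (intro power_mono) auto
    also have "\<dots> = l / (2 * (C + 1))" using l by (simp add: power_mult_distrib r)
    finally have "(C + 1) * (\<mu> n)\<^sup>2 \<le> l / 2" using C by (simp add: field_simps)
    then have "C * (\<mu> n)\<^sup>2 \<le> l / 2 + - (\<mu> n)\<^sup>2" by (simp add: algebra_simps)
    then have "exp (C * (\<mu> n)\<^sup>2) \<le> exp (l / 2) * exp (- (\<mu> n)\<^sup>2)"
      unfolding exp_add[symmetric] by simp
    moreover have "\<epsilon> n * exp (l / 2) = sqrt (\<epsilon> n)"
    proof -
      have "\<epsilon> n = exp (- l)" using elim by (simp add: l_def ln_div)
      then have "\<epsilon> n * exp (l / 2) = exp (- l / 2)" by (simp add: exp_add[symmetric])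
      moreover have "sqrt (\<epsilon> n) = exp (- l / 2)"
        using \<open>\<epsilon> n = exp (- l)\<close> by (intro real_sqrt_unique) (simp_all add: power2_eq_square exp_add[symmetric])
      ultimately show ?thesis by simp
    qed
    ultimately have "\<epsilon> n * exp (C * (\<mu> n)\<^sup>2) \<le> sqrt (\<epsilon> n) * exp (- (\<mu> n)\<^sup>2)"
      using elim by (metis less_imp_le mult.assoc mult_left_mono)
    then have "(\<mu> n) ^ p * (\<epsilon> n * exp (C * (\<mu> n)\<^sup>2)) \<le> (\<mu> n) ^ p * (sqrt (\<epsilon> n) * exp (- (\<mu> n)\<^sup>2))"
      using elim by (intro mult_left_mono) auto
    then show ?case by (simp add: algebra_simps)
  qed
  have "(\<lambda>n. sqrt (\<epsilon> n)) \<longlonglongrightarrow> sqrt 0" by (intro tendsto_real_sqrt eps)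
  moreover have "((\<lambda>x::real. x ^ p * exp (- x\<^sup>2)) \<longlongrightarrow> 0) at_top" by real_asymp
  then have "(\<lambda>n. (\<mu> n) ^ p * exp (- (\<mu> n)\<^sup>2)) \<longlonglongrightarrow> 0" using mu by (rule filterlim_compose)
  ultimately show "(\<lambda>n. sqrt (\<epsilon> n) * ((\<mu> n) ^ p * exp (- (\<mu> n)\<^sup>2))) \<longlonglongrightarrow> 0"
    using tendsto_mult by fastforce
qed

section \<open>Finite-sample bounds on the minimax risk and the normalised risk\<close>

lemma minimax_risk_lower_bound:
  fixes \<mu> \<sigma> :: real and n k m :: nat
  assumes m: "2 \<le> m" and kmn: "k * m \<le> n"
  defines "q \<equiv> exp (\<mu>\<^sup>2) / 2 * ((1 + exp (3 / 2 * \<mu>\<^sup>2) / real (m - 1)) / real (m - 1))"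
  shows "ereal (real k * (\<sigma> * \<mu>)\<^sup>2 * (1 - q)) \<le> enn2ereal (minimax_risk n \<sigma> (sparse_ball n k (\<sigma> * \<mu>)))"
proof -
  let ?a = "real k * (\<sigma> * \<mu>)\<^sup>2"
  have q: "0 \<le> q" by (simp add: q_def)
  have "ennreal (?a * (1 - q)) \<le> minimax_risk n \<sigma> (sparse_ball n k (\<sigma> * \<mu>))"
    unfolding minimax_risk_def
  proof (rule INF_greatest)
    fix est assume "est \<in> estimators n"
    from sup_risk_lower_bound[OF this m kmn, of \<sigma> \<mu>, folded q_def]
    have "ennreal ?a - ennreal (?a * q) \<le> sup_risk n \<sigma> (sparse_ball n k (\<sigma> * \<mu>)) est"
      by (simp add: ennreal_minus_le_iff add.commute)
    then show "ennreal (?a * (1 - q)) \<le> sup_risk n \<sigma> (sparse_ball n k (\<sigma> * \<mu>)) est"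
      using q by (simp add: ennreal_minus right_diff_distrib)
  qed
  then have "enn2ereal (ennreal (?a * (1 - q))) \<le> enn2ereal (minimax_risk n \<sigma> (sparse_ball n k (\<sigma> * \<mu>)))"
    by (simp add: less_eq_ennreal.rep_eq)
  \<comment> \<open>If \<open>1 - q\<close> is negative, \<open>ennreal\<close> turns the bound into
    zero, so only an inequality holds.\<close>
  moreover have "ereal (?a * (1 - q)) \<le> enn2ereal (ennreal (?a * (1 - q)))"
    by (cases "0 \<le> ?a * (1 - q)") (simp_all add: enn2ereal_ennreal ennreal_neg zero_ennreal.rep_eq)
  ultimately show ?thesis by (rule order_trans[rotated])
qed

text \<open>\<open>D\<close> is the coefficient of the correction. On the scale \<open>W\<close>,
  the gain at the spikes is \<open>G\<close>, the loss at the zeros is \<open>L\<close>, and the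
  second moment at the spikes gives the extra subtracted term; the lower risk bound has only
  \<open>n - k\<close> zeros, whence \<open>1 - \<epsilon>\<close>.\<close>

lemma sup_risk_eta_E_deviation:
  fixes \<sigma> \<mu> \<gamma> \<epsilon> :: real and n k :: nat
  assumes \<sigma>: "0 < \<sigma>" and \<mu>: "0 < \<mu>" and k: "1 \<le> k" "k \<le> n" and \<epsilon>: "\<epsilon> = real k / real n"
    and c: "1 / (1 + \<gamma>) = 2 * \<epsilon> * \<mu>\<^sup>2 * exp (3 / 2 * \<mu>\<^sup>2)" "8 * \<epsilon> * \<mu>\<^sup>2 * exp (3 / 2 * \<mu>\<^sup>2) \<le> 1"
  defines "D \<equiv> (\<epsilon> * \<mu>\<^sup>2 - enn2real (sup_risk n \<sigma> (sparse_ball n k (\<sigma> * \<mu>)) (eta_E n (\<sigma> * (2 * \<mu>)) \<gamma>)) / (real n * \<sigma>\<^sup>2))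
      / (\<epsilon>\<^sup>2 * \<mu> * exp (\<mu>\<^sup>2))"
    and "L \<equiv> 8 * \<mu> ^ 3 * exp (2 * \<mu>\<^sup>2) * tail_moment 2 (2 * \<mu>)"
    and "G \<equiv> 4 * \<mu>\<^sup>2 * exp (\<mu>\<^sup>2 / 2) * soft_mean (2 * \<mu>) \<mu>"
  shows "G - L - 8 * \<epsilon> * \<mu> ^ 3 * exp (2 * \<mu>\<^sup>2) * (1 + \<mu>\<^sup>2) \<le> D" and "D \<le> G - (1 - \<epsilon>) * L"
proof -
  let ?S = "sup_risk n \<sigma> (sparse_ball n k (\<sigma> * \<mu>)) (eta_E n (\<sigma> * (2 * \<mu>)) \<gamma>)"
  define c where "c = 1 / (1 + \<gamma>)"
  have c_eq: "c = 2 * \<epsilon> * \<mu>\<^sup>2 * exp (3 / 2 * \<mu>\<^sup>2)" by (simp add: c_def assms)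
  have n: "0 < real n" and \<epsilon>0: "0 < \<epsilon>" and kn: "real k = real n * \<epsilon>"
    using k by (simp_all add: \<epsilon>)
  have c0: "0 \<le> c" "4 * c \<le> 1" using c \<epsilon>0 by (simp_all add: c_eq)
  have a: "0 \<le> 2 * \<mu>" using \<mu> by simp
  define W where "W = \<epsilon>\<^sup>2 * \<mu> * exp (\<mu>\<^sup>2)"
  have W: "0 < W" using \<epsilon>0 \<mu> by (simp add: W_def)
  have exp3: "exp (3 / 2 * \<mu>\<^sup>2) * exp (3 / 2 * \<mu>\<^sup>2) = exp (\<mu>\<^sup>2) * exp (2 * \<mu>\<^sup>2)"
    "exp (3 / 2 * \<mu>\<^sup>2) = exp (\<mu>\<^sup>2) * exp (\<mu>\<^sup>2 / 2)"
    by (simp_all add: exp_add[symmetric])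
  have cc: "c\<^sup>2 = 4 * \<epsilon>\<^sup>2 * \<mu> ^ 4 * (exp (\<mu>\<^sup>2) * exp (2 * \<mu>\<^sup>2))"
    unfolding c_eq exp3(1)[symmetric] by (simp add: power2_eq_square power4_eq_xxxx)
  have L: "c\<^sup>2 * soft_square (2 * \<mu>) 0 = W * L"
    unfolding soft_square_0_eq[OF a] cc W_def L_def
    by (simp add: power2_eq_square power3_eq_cube power4_eq_xxxx)
  have G: "2 * c * \<epsilon> * \<mu> * soft_mean (2 * \<mu>) \<mu> = W * G"
    unfolding c_eq exp3(2) W_def G_def by (simp add: power2_eq_square)
  have H: "2 * c\<^sup>2 * \<epsilon> * (1 + \<mu>\<^sup>2) = W * (8 * \<epsilon> * \<mu> ^ 3 * exp (2 * \<mu>\<^sup>2) * (1 + \<mu>\<^sup>2))"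
    unfolding cc W_def by (simp add: power2_eq_square power3_eq_cube power4_eq_xxxx)
  have fin: "?S < \<top>" by (rule sup_risk_eta_E_finite[OF \<sigma> a])
  define x where "x = enn2real ?S"
  have x: "?S = ennreal x" "0 \<le> x" using fin by (simp_all add: x_def)
  have low: "\<sigma>\<^sup>2 * ((real n - real k) * (W * L) + real k * \<mu>\<^sup>2 - 2 * c * real k * \<mu> * soft_mean (2 * \<mu>) \<mu>) \<le> x"
    using sup_risk_eta_E_lower[OF \<sigma> a \<mu> k(2), of \<gamma>] x unfolding c_def[symmetric] L by simp
  \<comment> \<open>Nonnegativity of the upper bound is needed to carry the inequality from
    \<open>ennreal\<close> back to the reals.\<close>
  have "0 \<le> real k * (\<mu>\<^sup>2 - 2 * c * (\<mu> * soft_mean (2 * \<mu>) \<mu>) + c\<^sup>2 * (2 * \<mu>\<^sup>2 + 2))"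
  proof (intro mult_nonneg_nonneg)
    have "0 \<le> soft_risk c (2 * \<mu>) \<mu>" by (rule nn_integral_soft_risk(2)[OF a])
    also have "\<dots> \<le> \<mu>\<^sup>2 - 2 * c * (\<mu> * soft_mean (2 * \<mu>) \<mu>) + c\<^sup>2 * (2 * \<mu>\<^sup>2 + 2)"
      unfolding soft_risk_def by (intro add_left_mono mult_left_mono soft_square_le[OF a]) simp
    finally show "0 \<le> \<mu>\<^sup>2 - 2 * c * (\<mu> * soft_mean (2 * \<mu>) \<mu>) + c\<^sup>2 * (2 * \<mu>\<^sup>2 + 2)" .
  qed simp
  moreover have "0 \<le> real n * (W * L)"
    unfolding L[symmetric] by (simp add: soft_square_nonneg)
  ultimately have "0 \<le> real n * (W * L) + real k * \<mu>\<^sup>2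
          - 2 * c * real k * \<mu> * soft_mean (2 * \<mu>) \<mu> + 2 * c\<^sup>2 * real k * (1 + \<mu>\<^sup>2)"
    by (simp add: algebra_simps)
  then have up: "x \<le> \<sigma>\<^sup>2 * (real n * (W * L) + real k * \<mu>\<^sup>2
          - 2 * c * real k * \<mu> * soft_mean (2 * \<mu>) \<mu> + 2 * c\<^sup>2 * real k * (1 + \<mu>\<^sup>2))"
    using sup_risk_eta_E_upper[OF \<sigma> a \<mu>, of \<gamma> n k] c0 x unfolding c_def[symmetric] L
    by (simp add: ennreal_le_iff)
  have D: "D = (\<epsilon> * \<mu>\<^sup>2 - x / (real n * \<sigma>\<^sup>2)) / W" by (simp add: D_def x_def W_def)
  have Gk: "2 * c * real k * \<mu> * soft_mean (2 * \<mu>) \<mu> = real n * (W * G)"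
    unfolding G[symmetric] kn by simp
  have Hk: "2 * c\<^sup>2 * real k * (1 + \<mu>\<^sup>2) = real n * (W * (8 * \<epsilon> * \<mu> ^ 3 * exp (2 * \<mu>\<^sup>2) * (1 + \<mu>\<^sup>2)))"
    unfolding H[symmetric] kn by simp
  let ?H = "8 * \<epsilon> * \<mu> ^ 3 * exp (2 * \<mu>\<^sup>2) * (1 + \<mu>\<^sup>2)"
  have "x \<le> (\<epsilon> * \<mu>\<^sup>2 - W * (G - L - ?H)) * (real n * \<sigma>\<^sup>2)"
    using up[unfolded Gk Hk, unfolded kn] by (simp add: algebra_simps)
  then have "x / (real n * \<sigma>\<^sup>2) \<le> \<epsilon> * \<mu>\<^sup>2 - W * (G - L - ?H)"
    using n \<sigma> by (simp add: pos_divide_le_eq)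
  then show "G - L - ?H \<le> D"
    unfolding D using W by (simp add: pos_le_divide_eq mult.commute)
  have "(\<epsilon> * \<mu>\<^sup>2 - W * (G - (1 - \<epsilon>) * L)) * (real n * \<sigma>\<^sup>2) \<le> x"
    using low[unfolded Gk, unfolded kn] by (simp add: algebra_simps)
  then have "\<epsilon> * \<mu>\<^sup>2 - W * (G - (1 - \<epsilon>) * L) \<le> x / (real n * \<sigma>\<^sup>2)"
    using n \<sigma> by (simp add: pos_le_divide_eq)
  then show "D \<le> G - (1 - \<epsilon>) * L"
    unfolding D using W by (simp add: pos_divide_le_eq mult.commute)
qed

text \<open>Rounding down \<open>1 / \<epsilon>\<close> loses less than one and the coordinate
  dropped from each block loses one more, so the error is at most
  \<open>2 * \<epsilon> n\<close>.\<close>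

lemma block_count_tendsto:
  fixes k :: "nat \<Rightarrow> nat" and \<epsilon> :: "nat \<Rightarrow> real"
  assumes k: "\<And>n. n \<ge> 1 \<Longrightarrow> 1 \<le> k n \<and> k n \<le> n"
    and eps: "\<And>n. \<epsilon> n = real (k n) / real n" "\<epsilon> \<longlonglongrightarrow> 0"
  shows "(\<lambda>n. \<epsilon> n * (real (n div k n) - 1)) \<longlonglongrightarrow> 1"
proof (rule tendsto_sandwich)
  have bounds: "1 - 2 * \<epsilon> n \<le> \<epsilon> n * (real (n div k n) - 1)" "\<epsilon> n * (real (n div k n) - 1) \<le> 1" if "1 \<le> n" for n
  proof -
    have \<epsilon>: "0 < \<epsilon> n" and inv: "real n / real (k n) = 1 / \<epsilon> n"
      using k[OF that] that by (simp_all add: eps(1))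
    have "1 / \<epsilon> n - 2 \<le> real (n div k n) - 1" "real (n div k n) - 1 \<le> 1 / \<epsilon> n"
      using floor_correct[of "real n / real (k n)", unfolded floor_divide_of_nat_eq, unfolded inv] by auto
    then have "\<epsilon> n * (1 / \<epsilon> n - 2) \<le> \<epsilon> n * (real (n div k n) - 1)"
      "\<epsilon> n * (real (n div k n) - 1) \<le> \<epsilon> n * (1 / \<epsilon> n)"
      using \<epsilon> by (intro mult_left_mono; simp)+
    then show "1 - 2 * \<epsilon> n \<le> \<epsilon> n * (real (n div k n) - 1)" "\<epsilon> n * (real (n div k n) - 1) \<le> 1"
      using \<epsilon> by (simp_all add: right_diff_distrib mult.commute)
  qed
  show "eventually (\<lambda>n. 1 - 2 * \<epsilon> n \<le> \<epsilon> n * (real (n div k n) - 1)) sequentially"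
    by (rule eventually_mono[OF eventually_ge_at_top bounds(1)])
  show "eventually (\<lambda>n. \<epsilon> n * (real (n div k n) - 1) \<le> 1) sequentially"
    by (rule eventually_mono[OF eventually_ge_at_top bounds(2)])
  have "(\<lambda>n. 1 - 2 * \<epsilon> n) \<longlonglongrightarrow> 1 - 2 * 0" by (intro tendsto_intros eps)
  then show "(\<lambda>n. 1 - 2 * \<epsilon> n) \<longlonglongrightarrow> 1" by simp
qed simp

theorem theorem4:
  fixes k :: "nat \<Rightarrow> nat"
    and \<tau> \<sigma> \<epsilon> \<mu> lam \<gamma> :: "nat \<Rightarrow> real"
  assumes k_range: "\<And>n. n \<ge> 1 \<Longrightarrow> 1 \<le> k n \<and> k n \<le> n"
    and tau_pos: "\<And>n. n \<ge> 1 \<Longrightarrow> \<tau> n > 0"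
    and sigma_pos: "\<And>n. n \<ge> 1 \<Longrightarrow> \<sigma> n > 0"
    and eps_eq: "\<And>n. \<epsilon> n = real (k n) / real n"
    and mu_eq: "\<And>n. \<mu> n = \<tau> n / \<sigma> n"
    and eps_lim: "\<epsilon> \<longlonglongrightarrow> 0"
    and mu_lim: "filterlim \<mu> at_top sequentially"
    and mu_small: "(\<lambda>n. \<mu> n / sqrt (ln (1 / \<epsilon> n))) \<longlonglongrightarrow> 0"
    and lam_eq: "\<And>n. lam n = 2 * \<sigma> n * \<mu> n"
    and gamma_eq: "\<And>n. \<gamma> n = inverse (2 * \<epsilon> n * (\<mu> n)\<^sup>2 * exp (3 / 2 * (\<mu> n)\<^sup>2)) - 1"
  shows
    "(\<exists>\<delta> :: nat \<Rightarrow> real. \<delta> \<longlonglongrightarrow> 0 \<and>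
        (\<forall>n\<ge>1. enn2ereal (minimax_risk n (\<sigma> n) (sparse_ball n (k n) (\<tau> n))) \<ge>
           ereal (real n * (\<sigma> n)\<^sup>2 *
             (\<epsilon> n * (\<mu> n)\<^sup>2
              - 1 / 2 * (\<epsilon> n)\<^sup>2 * (\<mu> n)\<^sup>2 * exp ((\<mu> n)\<^sup>2) * (1 + \<delta> n))))) \<and>
     (\<forall>n\<ge>1. minimax_risk n (\<sigma> n) (sparse_ball n (k n) (\<tau> n)) \<le>
        sup_risk n (\<sigma> n) (sparse_ball n (k n) (\<tau> n)) (eta_E n (lam n) (\<gamma> n))) \<and>
     (\<exists>\<delta> :: nat \<Rightarrow> real. \<delta> \<longlonglongrightarrow> 0 \<and>
        (\<forall>n\<ge>1. enn2ereal (sup_risk n (\<sigma> n) (sparse_ball n (k n) (\<tau> n)) (eta_E n (lam n) (\<gamma> n))) =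
           ereal (real n * (\<sigma> n)\<^sup>2 *
             (\<epsilon> n * (\<mu> n)\<^sup>2
              - (sqrt (2 / pi) + \<delta> n) * (\<epsilon> n)\<^sup>2 * \<mu> n * exp ((\<mu> n)\<^sup>2)))))"
proof (intro conjI)
  have pos: "0 < \<epsilon> n" "0 < \<mu> n" "real n * \<epsilon> n = real (k n)" "\<tau> n = \<sigma> n * \<mu> n" if "1 \<le> n" for n
    using k_range[OF that] tau_pos[OF that] sigma_pos[OF that] that by (simp_all add: eps_eq mu_eq)
  have ev1: "eventually (\<lambda>n::nat. 1 \<le> n) sequentially" by (rule eventually_ge_at_top)
  have eps_pos: "eventually (\<lambda>n. 0 < \<epsilon> n) sequentially"
    using ev1 by eventually_elim (rule pos)
  note sparse = sparsity_beats_exp[OF eps_lim eps_pos mu_lim mu_small]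

  \<comment> \<open>Minimax lower bound with blocks of size n div k\<close>
  show "\<exists>\<delta> :: nat \<Rightarrow> real. \<delta> \<longlonglongrightarrow> 0 \<and>
        (\<forall>n\<ge>1. enn2ereal (minimax_risk n (\<sigma> n) (sparse_ball n (k n) (\<tau> n))) \<ge>
           ereal (real n * (\<sigma> n)\<^sup>2 *
             (\<epsilon> n * (\<mu> n)\<^sup>2
              - 1 / 2 * (\<epsilon> n)\<^sup>2 * (\<mu> n)\<^sup>2 * exp ((\<mu> n)\<^sup>2) * (1 + \<delta> n))))"
  proof -
    define w where "w n = \<epsilon> n * (real (n div k n) - 1)" for n
    have w: "w \<longlonglongrightarrow> 1"
      unfolding w_def[abs_def] using k_range eps_eq eps_lim by (rule block_count_tendsto)
    \<comment> \<open>The first case solves for the correction of the finite bound. In the second,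
      blocks have fewer than two coordinates and \<delta> makes the claimed bound zero; this happens
      for finitely many n only.\<close>
    define \<delta> where "\<delta> n = (if 2 \<le> n div k n then (1 + \<epsilon> n * exp (3 / 2 * (\<mu> n)\<^sup>2) / w n) / w n - 1
        else 2 / (\<epsilon> n * exp ((\<mu> n)\<^sup>2)) - 1)" for n
    have "eventually (\<lambda>n. 2 \<le> n div k n) sequentially"
      using ev1 eps_pos order_tendstoD(1)[OF w, of 0, simplified]
    proof eventually_elim
      case (elim n)
      then have "1 < real (n div k n)" by (simp add: w_def zero_less_mult_iff)
      then show ?case by linarith
    qed
    then have ev: "eventually (\<lambda>n. (1 + \<epsilon> n * exp (3 / 2 * (\<mu> n)\<^sup>2) / w n) / w n - 1 = \<delta> n) sequentially"
      by eventually_elim (simp add: \<delta>_def)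
    have "(\<lambda>n. \<epsilon> n * exp (3 / 2 * (\<mu> n)\<^sup>2)) \<longlonglongrightarrow> 0"
      using sparse[of "3 / 2" 0] by simp
    then have "(\<lambda>n. (1 + \<epsilon> n * exp (3 / 2 * (\<mu> n)\<^sup>2) / w n) / w n - 1) \<longlonglongrightarrow> (1 + 0 / 1) / 1 - 1"
      by (intro tendsto_intros w) auto
    then have \<delta>: "\<delta> \<longlonglongrightarrow> 0"
      using Lim_transform_eventually[OF _ ev] by simp
    have "ereal (real n * (\<sigma> n)\<^sup>2 * (\<epsilon> n * (\<mu> n)\<^sup>2
              - 1 / 2 * (\<epsilon> n)\<^sup>2 * (\<mu> n)\<^sup>2 * exp ((\<mu> n)\<^sup>2) * (1 + \<delta> n)))
        \<le> enn2ereal (minimax_risk n (\<sigma> n) (sparse_ball n (k n) (\<tau> n)))" if n: "1 \<le> n" for n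
    proof (cases "2 \<le> n div k n")
      case True
      define v where "v = real (n div k n - 1)"
      have v: "0 < v" "w n = \<epsilon> n * v" using True by (simp_all add: v_def w_def of_nat_diff)
      define q where "q = exp ((\<mu> n)\<^sup>2) / 2 * ((1 + exp (3 / 2 * (\<mu> n)\<^sup>2) / v) / v)"
      have "1 + \<delta> n = (1 + exp (3 / 2 * (\<mu> n)\<^sup>2) / v) / (\<epsilon> n * v)"
        using True pos(1)[OF n] by (simp add: \<delta>_def v(2))
      then have "1 / 2 * (\<epsilon> n)\<^sup>2 * (\<mu> n)\<^sup>2 * exp ((\<mu> n)\<^sup>2) * (1 + \<delta> n) = \<epsilon> n * (\<mu> n)\<^sup>2 * q"
        using pos(1)[OF n] by (simp add: q_def power2_eq_square)
      then have "real n * (\<sigma> n)\<^sup>2 * (\<epsilon> n * (\<mu> n)\<^sup>2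
              - 1 / 2 * (\<epsilon> n)\<^sup>2 * (\<mu> n)\<^sup>2 * exp ((\<mu> n)\<^sup>2) * (1 + \<delta> n))
          = real (k n) * (\<sigma> n * \<mu> n)\<^sup>2 * (1 - q)"
        unfolding pos(3)[OF n, symmetric] by (simp add: power_mult_distrib algebra_simps)
      moreover have "k n * (n div k n) \<le> n" by simp
      ultimately show ?thesis
        using minimax_risk_lower_bound[OF True, of "k n" n "\<sigma> n" "\<mu> n"] pos(4)[OF n]
        by (simp add: q_def v_def)
    next
      case False
      have "(\<epsilon> n)\<^sup>2 * exp ((\<mu> n)\<^sup>2) * (1 + \<delta> n) = 2 * \<epsilon> n"
        using False pos(1)[OF n] by (simp add: \<delta>_def power2_eq_square)
      moreover have "1 / 2 * (\<epsilon> n)\<^sup>2 * (\<mu> n)\<^sup>2 * exp ((\<mu> n)\<^sup>2) * (1 + \<delta> n)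
          = (\<mu> n)\<^sup>2 / 2 * ((\<epsilon> n)\<^sup>2 * exp ((\<mu> n)\<^sup>2) * (1 + \<delta> n))"
        by simp
      ultimately have zero: "\<epsilon> n * (\<mu> n)\<^sup>2 - 1 / 2 * (\<epsilon> n)\<^sup>2 * (\<mu> n)\<^sup>2 * exp ((\<mu> n)\<^sup>2) * (1 + \<delta> n) = 0"
        by simp
      show ?thesis unfolding zero by (simp add: enn2ereal_nonneg zero_ereal_def[symmetric])
    qed
    with \<delta> show ?thesis by blast
  qed

  show "\<forall>n\<ge>1. minimax_risk n (\<sigma> n) (sparse_ball n (k n) (\<tau> n)) \<le>
        sup_risk n (\<sigma> n) (sparse_ball n (k n) (\<tau> n)) (eta_E n (lam n) (\<gamma> n))"
    unfolding minimax_risk_def by (blast intro: INF_lower eta_E_in_estimators)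

  \<comment> \<open>Exact first-order correction of the worst-case risk\<close>
  show "\<exists>\<delta> :: nat \<Rightarrow> real. \<delta> \<longlonglongrightarrow> 0 \<and>
        (\<forall>n\<ge>1. enn2ereal (sup_risk n (\<sigma> n) (sparse_ball n (k n) (\<tau> n)) (eta_E n (lam n) (\<gamma> n))) =
           ereal (real n * (\<sigma> n)\<^sup>2 *
             (\<epsilon> n * (\<mu> n)\<^sup>2
              - (sqrt (2 / pi) + \<delta> n) * (\<epsilon> n)\<^sup>2 * \<mu> n * exp ((\<mu> n)\<^sup>2))))"
  proof -
    let ?S = "\<lambda>n. sup_risk n (\<sigma> n) (sparse_ball n (k n) (\<tau> n)) (eta_E n (lam n) (\<gamma> n))"
    have S_eq: "?S n = sup_risk n (\<sigma> n) (sparse_ball n (k n) (\<sigma> n * \<mu> n)) (eta_E n (\<sigma> n * (2 * \<mu> n)) (\<gamma> n))"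
      if "1 \<le> n" for n
      using pos(4)[OF that] by (simp add: lam_eq algebra_simps)
    \<comment> \<open>Defining the coefficient from the risk itself makes the equality hold for
      every n from 1 on; only its convergence needs the estimates.\<close>
    define D where "D n = (\<epsilon> n * (\<mu> n)\<^sup>2 - enn2real (?S n) / (real n * (\<sigma> n)\<^sup>2)) / ((\<epsilon> n)\<^sup>2 * \<mu> n * exp ((\<mu> n)\<^sup>2))" for n
    define L where "L n = 8 * (\<mu> n) ^ 3 * exp (2 * (\<mu> n)\<^sup>2) * tail_moment 2 (2 * \<mu> n)" for n
    define G where "G n = 4 * (\<mu> n)\<^sup>2 * exp ((\<mu> n)\<^sup>2 / 2) * soft_mean (2 * \<mu> n) (\<mu> n)" for n
    define H where "H n = 8 * \<epsilon> n * (\<mu> n) ^ 3 * exp (2 * (\<mu> n)\<^sup>2) * (1 + (\<mu> n)\<^sup>2)" for n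
    have L: "L \<longlonglongrightarrow> sqrt (2 / pi)"
      unfolding L_def[abs_def] by (rule filterlim_compose[OF tail_moment_2_asymp mu_lim])
    have G: "G \<longlonglongrightarrow> 2 * sqrt (2 / pi)"
      unfolding G_def[abs_def] by (rule filterlim_compose[OF soft_mean_asymp mu_lim])
    have "(\<lambda>n. 8 * (\<epsilon> n * (\<mu> n) ^ 3 * exp (2 * (\<mu> n)\<^sup>2)) + 8 * (\<epsilon> n * (\<mu> n) ^ 5 * exp (2 * (\<mu> n)\<^sup>2))) \<longlonglongrightarrow> 8 * 0 + 8 * 0"
      by (intro tendsto_intros sparse) auto
    then have H: "H \<longlonglongrightarrow> 0"
      unfolding H_def[abs_def] by (simp add: algebra_simps power_add[symmetric])
    \<comment> \<open>This makes \<open>4 * c \<le> 1\<close> hold eventually, as the worst-case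
      bound demands.\<close>
    have "(\<lambda>n. 8 * \<epsilon> n * (\<mu> n)\<^sup>2 * exp (3 / 2 * (\<mu> n)\<^sup>2)) \<longlonglongrightarrow> 0"
      using tendsto_mult_right_zero[OF sparse[of "3 / 2" 2], of 8] by (simp add: mult.assoc)
    from order_tendstoD(2)[OF this zero_less_one] ev1
    have sandwich: "eventually (\<lambda>n. G n - L n - H n \<le> D n \<and> D n \<le> G n - (1 - \<epsilon> n) * L n) sequentially"
    proof eventually_elim
      case (elim n)
      have "1 / (1 + \<gamma> n) = 2 * \<epsilon> n * (\<mu> n)\<^sup>2 * exp (3 / 2 * (\<mu> n)\<^sup>2)"
        by (simp add: gamma_eq inverse_eq_divide)
      then show ?case
        using sup_risk_eta_E_deviation[of "\<sigma> n" "\<mu> n" "k n" n "\<epsilon> n" "\<gamma> n"]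
          sigma_pos[OF elim(2)] pos[OF elim(2)] k_range[OF elim(2)] eps_eq[of n] elim(1)
        unfolding G_def L_def H_def D_def S_eq[OF elim(2)] by simp
    qed
    have "(\<lambda>n. G n - L n - H n) \<longlonglongrightarrow> 2 * sqrt (2 / pi) - sqrt (2 / pi) - 0"
      by (intro tendsto_intros G L H)
    moreover have "(\<lambda>n. G n - (1 - \<epsilon> n) * L n) \<longlonglongrightarrow> 2 * sqrt (2 / pi) - (1 - 0) * sqrt (2 / pi)"
      by (intro tendsto_intros G L eps_lim)
    ultimately have D: "D \<longlonglongrightarrow> sqrt (2 / pi)"
      using sandwich by (intro tendsto_sandwich[of "\<lambda>n. G n - L n - H n" D _ "\<lambda>n. G n - (1 - \<epsilon> n) * L n"])
        (auto elim: eventually_mono)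
    have "(\<lambda>n. D n - sqrt (2 / pi)) \<longlonglongrightarrow> 0"
      using tendsto_diff[OF D tendsto_const[of "sqrt (2 / pi)"]] by simp
    moreover have "enn2ereal (?S n) = ereal (real n * (\<sigma> n)\<^sup>2 * (\<epsilon> n * (\<mu> n)\<^sup>2
              - (sqrt (2 / pi) + (D n - sqrt (2 / pi))) * (\<epsilon> n)\<^sup>2 * \<mu> n * exp ((\<mu> n)\<^sup>2)))" if n: "1 \<le> n" for n
    proof -
      have "?S n < \<top>"
        unfolding S_eq[OF n] using sigma_pos[OF n] pos(2)[OF n] by (intro sup_risk_eta_E_finite) auto
      then have "?S n = ennreal (enn2real (?S n))" by simp
      then have "enn2ereal (?S n) = ereal (enn2real (?S n))"
        by (metis enn2ereal_ennreal enn2real_nonneg)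
      moreover have "D n * ((\<epsilon> n)\<^sup>2 * \<mu> n * exp ((\<mu> n)\<^sup>2)) = \<epsilon> n * (\<mu> n)\<^sup>2 - enn2real (?S n) / (real n * (\<sigma> n)\<^sup>2)"
        using pos[OF n] by (simp add: D_def)
      then have "\<epsilon> n * (\<mu> n)\<^sup>2 - (sqrt (2 / pi) + (D n - sqrt (2 / pi))) * (\<epsilon> n)\<^sup>2 * \<mu> n * exp ((\<mu> n)\<^sup>2)
          = enn2real (?S n) / (real n * (\<sigma> n)\<^sup>2)"
        by (simp add: mult.assoc)
      then have "real n * (\<sigma> n)\<^sup>2 * (\<epsilon> n * (\<mu> n)\<^sup>2
              - (sqrt (2 / pi) + (D n - sqrt (2 / pi))) * (\<epsilon> n)\<^sup>2 * \<mu> n * exp ((\<mu> n)\<^sup>2)) = enn2real (?S n)"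
        using n sigma_pos[OF n] by simp
      ultimately show ?thesis by simp
    qed
    ultimately show ?thesis by (intro exI[of _ "\<lambda>n. D n - sqrt (2 / pi)"]) blast
  qed
qed

end
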